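(* Let $k_1,k_2$ be integers with $0\le k_1\le k_2$ and $4\le k_1+k_2\le 14$, and let $m$ be a positive integer. If there exists a purely singular perfect $B[-k_1,k_2](m)$ set, then $m=1$, or $m=k_1+k_2+1$, or ($k_1=0$ and $m=2(k_1+k_2)+1$).
   Context: For integers $a\le b$, $[a,b]=\{a,a+1,\dots,b\}$. For a positive integer $q$ and integers $0\le k_1\le k_2$, a set $B\subseteq\mathbb{Z}_q$ of size $n$ is a $B[-k_1,k_2](q)$ set if the sets $\{ab \bmod q : a\in[-k_1,k_2]\}$, $b\in B$, each have exactly $k_1+k_2$ nonzero elements and are pairwise disjoint (as sets of nonzero elements). It is perfect if $n=(q-1)/(k_1+k_2)$. A perfect $B[-k_1,k_2](q)$ set is purely singular if for every prime $p\mid q$ there is some $k$ with $0<k\le k_2$ and $p\mid k$. *)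

theory Defs
  imports Complex_Main "HOL-Computational_Algebra.Primes"
begin

text \<open>The residue ring modulo \<open>q\<close> is represented by its least nonnegative residues
  \<open>{0..<q}\<close>. The definitions are meant for \<open>q > 0\<close> and \<open>0 \<le> k1 \<le> k2\<close> with \<open>0 < k1 + k2\<close>.\<close>

definition nonzero_multiples :: "int \<Rightarrow> int \<Rightarrow> int \<Rightarrow> int \<Rightarrow> int set" where
  "nonzero_multiples k1 k2 q b = {a * b mod q | a. a \<in> {-k1..k2}} - {0}"

definition B_set :: "int \<Rightarrow> int \<Rightarrow> int \<Rightarrow> int set \<Rightarrow> bool" where
  "B_set k1 k2 q B \<longleftrightarrow>
     B \<subseteq> {0..<q} \<and>
     (\<forall>b\<in>B. int (card (nonzero_multiples k1 k2 q b)) = k1 + k2) \<and>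
     (\<forall>b\<in>B. \<forall>b'\<in>B. b \<noteq> b' \<longrightarrow>
        nonzero_multiples k1 k2 q b \<inter> nonzero_multiples k1 k2 q b' = {})"

definition perfect_B_set :: "int \<Rightarrow> int \<Rightarrow> int \<Rightarrow> int set \<Rightarrow> bool" where
  "perfect_B_set k1 k2 q B \<longleftrightarrow>
     B_set k1 k2 q B \<and> real (card B) = real_of_int (q - 1) / real_of_int (k1 + k2)"

definition purely_singular_perfect_B_set :: "int \<Rightarrow> int \<Rightarrow> int \<Rightarrow> int set \<Rightarrow> bool" where
  "purely_singular_perfect_B_set k1 k2 q B \<longleftrightarrow>
     perfect_B_set k1 k2 q B \<and>
     (\<forall>p. prime p \<and> p dvd q \<longrightarrow> (\<exists>k. 0 < k \<and> k \<le> k2 \<and> p dvd k))"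

end

theory Submission
  imports Defs "HOL-Number_Theory.Number_Theory"
begin

text \<open>
  In a perfect splitting every nonzero residue is \<open>s b\<close> for exactly one multiplier \<open>s\<close> and one
  \<open>b \<in> B\<close>. Counting the pairs with \<open>d | s b\<close> for each divisor \<open>d\<close> of \<open>m\<close> gives linear equations for the
  numbers of elements of \<open>B\<close> with a given gcd with \<open>m\<close>; their nonnegativity and integrality exclude
  all \<open>m\<close> except the claimed ones, three values of \<open>m\<close> with \<open>|B| = 2\<close>, and powers of certain primes.

  For \<open>m = p\<^sup>a\<close> the multipliers prime to \<open>p\<close> and the units in \<open>B\<close> factor the unit group, and so do,
  modulo \<open>p\<^bsup>a-1\<^esup>\<close>, the multipliers of valuation 1 and the units in \<open>B\<close> in suitable cases.
  If \<open>p\<close> divides the number of multipliers in the factorization, then the Frobenius map of the group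
  ring modulo \<open>p\<close> shows that replacing each multiplier by its \<open>p\<^sup>n\<close>-th power covers each unit a multiple
  of \<open>p\<close> times. For \<open>n = a - 2\<close> those powers only depend on the multipliers modulo \<open>p\<^sup>2\<close>, which leaves a
  finite problem that has no solution; hence \<open>a\<close> is small.
\<close>

subsection \<open>Counting in perfect splittings\<close>

text \<open>Divisor counts alone cannot bound the exponent: with \<open>p + 1\<close> multipliers,
  one of valuation 1 and the others prime to \<open>p\<close>, they are consistent for
  \<open>m = p ^ a\<close> with any even \<open>a\<close>. The finite problem modulo
  \<open>p ^ 2\<close> becomes contradictory because \<open>p\<close> itself is a multiplier:
  \<open>p * b = p * b'\<close> modulo \<open>m\<close> forces \<open>b = b'\<close>, so inverses of
  elements of \<open>B\<close> that agree modulo \<open>p ^ (a - 1)\<close> agree modulo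
  \<open>p ^ a\<close>. On \<open>p ^ (a - 2)\<close>-th powers this leaves at most one class modulo
  \<open>p ^ 2\<close> above each class modulo \<open>p\<close>. If there are exactly
  \<open>p\<close> multipliers in the factorization, the divisibility by \<open>p\<close> makes the
  indicator 1 along all powers of 2, and \<open>2 ^ (p - 1)\<close> would have to be 1 modulo
  \<open>p ^ 2\<close>; none of the primes at hand is a Wieferich prime. With more multipliers,
  further classes modulo \<open>p\<close> exclude each other, either because \<open>- p\<close> is a
  multiplier too or because the multipliers of valuation 1 are \<open>p\<close> and
  \<open>2 * p\<close>. At \<open>p = 2\<close> explicit powers of 9 and 25 take over.\<close>

locale perfect_splitting =
  fixes k1 k2 m :: int and B S :: "int set"
  assumes k1_nonneg: "0 \<le> k1" and k1_le_k2: "k1 \<le> k2" and k_pos: "0 < k1 + k2"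
    and m_pos: "0 < m"
    and perfect: "perfect_B_set k1 k2 m B"
  defines "S \<equiv> {-k1..k2} - {0}"
begin

lemma finite_S [simp]: "finite S" and zero_notin_S [simp]: "0 \<notin> S"
  by (auto simp: S_def)

lemma card_S: "int (card S) = k1 + k2"
  using k1_nonneg k1_le_k2 by (simp add: S_def)

lemma B_subset: "B \<subseteq> {0..<m}"
  using perfect by (simp add: perfect_B_set_def B_set_def)

lemma finite_B [simp]: "finite B"
  using B_subset finite_subset by blast

lemma card_B: "int (card B) * (k1 + k2) = m - 1"
proof -
  have "real (card B) * real_of_int (k1 + k2) = real_of_int (m - 1)"
    using perfect k_pos by (simp add: perfect_B_set_def)
  then have "real_of_int (int (card B) * (k1 + k2)) = real_of_int (m - 1)"
    by simp
  then show ?thesis by linarith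
qed

lemma card_multiples: "b \<in> B \<Longrightarrow> int (card (nonzero_multiples k1 k2 m b)) = k1 + k2"
  using perfect by (simp add: perfect_B_set_def B_set_def)

lemma multiples_subset: "nonzero_multiples k1 k2 m b \<subseteq> (\<lambda>s. s * b mod m) ` S"
  by (auto simp: nonzero_multiples_def S_def)

text \<open>\<open>S\<close> has as many elements as the set of nonzero multiples of
  \<open>b\<close>, so removing 0 from the image of \<open>S\<close> removes nothing: no multiplier
  in \<open>S\<close> annihilates an element of \<open>B\<close>.\<close>

lemma multiples_eq:
  assumes "b \<in> B"
  shows "nonzero_multiples k1 k2 m b = (\<lambda>s. s * b mod m) ` S"
proof -
  have "card ((\<lambda>s. s * b mod m) ` S) \<le> card (nonzero_multiples k1 k2 m b)"
    using card_image_le[of S "\<lambda>s. s * b mod m"] card_S card_multiples[OF assms] by simp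
  then show ?thesis
    using multiples_subset by (intro card_seteq) auto
qed

text \<open>Disjointness and the size of each set of multiples give injectivity; surjectivity
  follows because perfection makes the number of pairs equal to \<open>m - 1\<close>.\<close>

lemma bij_mult: "bij_betw (\<lambda>(s, b). s * b mod m) (S \<times> B) {1..<m}"
proof -
  let ?f = "\<lambda>(s, b). s * b mod m"
  have inj: "inj_on ?f (S \<times> B)"
  proof (rule inj_onI, clarify)
    fix s b s' b'
    assume *: "s \<in> S" "b \<in> B" "s' \<in> S" "b' \<in> B" "s * b mod m = s' * b' mod m"
    have "s * b mod m \<in> nonzero_multiples k1 k2 m b \<inter> nonzero_multiples k1 k2 m b'"
      using * by (auto simp: multiples_eq intro: rev_image_eqI)
    then have b: "b = b'"
      using perfect * unfolding perfect_B_set_def B_set_def by blast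
    have "inj_on (\<lambda>s. s * b mod m) S"
      using multiples_eq[OF \<open>b \<in> B\<close>] card_S card_multiples[OF \<open>b \<in> B\<close>]
      by (intro eq_card_imp_inj_on) auto
    with * b show "s = s' \<and> b = b'"
      by (auto dest: inj_onD)
  qed
  have sub: "?f ` (S \<times> B) \<subseteq> {1..<m}"
  proof (clarify)
    fix s b assume "s \<in> S" "b \<in> B"
    then have "s * b mod m \<in> nonzero_multiples k1 k2 m b"
      by (simp add: multiples_eq)
    then have "s * b mod m \<noteq> 0"
      by (simp add: nonzero_multiples_def)
    then show "s * b mod m \<in> {1..<m}"
      using m_pos pos_mod_bound[of m "s * b"] pos_mod_sign[of m "s * b"] by (simp del: pos_mod_sign pos_mod_bound)
  qed
  have "int (card (?f ` (S \<times> B))) = int (card {1..<m})"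
    using card_S card_B m_pos by (simp add: card_image[OF inj] card_cartesian_product mult.commute)
  then have "?f ` (S \<times> B) = {1..<m}"
    using sub by (simp only: card_seteq[OF finite_atLeastLessThan_int] of_nat_eq_iff)
  with inj show ?thesis by (simp add: bij_betw_def)
qed

lemma mult_inj:
  assumes "s \<in> S" "b \<in> B" "s' \<in> S" "b' \<in> B" "[s * b = s' * b'] (mod m)"
  shows "s = s' \<and> b = b'"
  using inj_onD[OF bij_betw_imp_inj_on[OF bij_mult], of "(s, b)" "(s', b')"] assms
  by (simp add: cong_def)

lemma mult_surj:
  assumes "\<not> m dvd y"
  obtains s b where "s \<in> S" "b \<in> B" "[s * b = y] (mod m)"
proof -
  have "y mod m \<noteq> 0" using assms by auto
  then have "y mod m \<in> {1..<m}"
    using m_pos pos_mod_bound[of m y] pos_mod_sign[of m y] by (simp del: pos_mod_sign pos_mod_bound)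
  then have "y mod m \<in> (\<lambda>(s, b). s * b mod m) ` (S \<times> B)"
    using bij_betw_imp_surj_on[OF bij_mult] by simp
  then show thesis using that by (auto simp: cong_def)
qed

lemma sum_dvd:
  assumes "d dvd m" "0 < d"
  shows "(\<Sum>b\<in>B. \<Sum>s\<in>S. if d dvd s * b then 1 else 0) = m div d - 1"
proof -
  obtain x where x: "m = d * x" using assms by blast
  with m_pos assms have "0 < x" by (simp add: zero_less_mult_iff)
  have eq: "{y \<in> {1..<m}. d dvd y} = (*) d ` {1..<x}"
  proof (intro equalityI subsetI)
    fix y assume y: "y \<in> {y \<in> {1..<m}. d dvd y}"
    then obtain z where z: "y = d * z" by (blast elim: dvdE)
    have "0 < d * z" "d * z < d * x" using y unfolding z x by simp_all
    with \<open>0 < d\<close> have "z \<in> {1..<x}"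
      by (simp add: zero_less_mult_iff mult_less_cancel_left_pos)
    with z show "y \<in> (*) d ` {1..<x}" by blast
  next
    fix y assume "y \<in> (*) d ` {1..<x}"
    then obtain z where z: "y = d * z" "z \<in> {1..<x}" by blast
    with \<open>0 < d\<close> show "y \<in> {y \<in> {1..<m}. d dvd y}"
      unfolding x z(1) by (simp add: int_one_le_iff_zero_less)
  qed
  have "(\<Sum>b\<in>B. \<Sum>s\<in>S. if d dvd s * b then 1 else (0::int))
      = (\<Sum>(s, b)\<in>S \<times> B. if d dvd s * b mod m then 1 else 0)"
    using assms by (subst sum.swap) (simp add: sum.cartesian_product dvd_mod_iff)
  also have "\<dots> = (\<Sum>y\<in>{1..<m}. if d dvd y then 1 else 0)"
    using sum.reindex_bij_betw[OF bij_mult, of "\<lambda>y. if d dvd y then 1 else (0::int)"]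
    by (simp add: case_prod_unfold)
  also have "\<dots> = int (card {y \<in> {1..<m}. d dvd y})"
    by (simp add: sum.If_cases Int_def)
  also have "\<dots> = x - 1"
    unfolding eq using \<open>0 < d\<close> \<open>0 < x\<close> by (simp add: card_image inj_on_def)
  finally show ?thesis using x \<open>0 < d\<close> by simp
qed

end

subsection \<open>Checking certificates\<close>

definition weight :: "(int \<times> int) list \<Rightarrow> int \<Rightarrow> int" where
  "weight h y = (\<Sum>(d, c)\<leftarrow>h. if d dvd y then c else 0)"

text \<open>For an admissible \<open>h\<close> this is the sum of \<open>weight h\<close> over a
  full period modulo \<open>D\<close>. Over all residues modulo \<open>D * x\<close> the sum is
  \<open>total h D * x\<close>; the residue 0, which no pair reaches, accounts for the coefficient
  sum subtracted later.\<close>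

definition total :: "(int \<times> int) list \<Rightarrow> int \<Rightarrow> int" where
  "total h D = (\<Sum>(d, c)\<leftarrow>h. c * (D div d))"

definition multipliers :: "int \<Rightarrow> int \<Rightarrow> int list" where
  "multipliers k1 k2 = filter (\<lambda>s. s \<noteq> 0) [-k1..k2]"

definition row_weight :: "int list \<Rightarrow> (int \<times> int) list \<Rightarrow> int \<Rightarrow> int" where
  "row_weight S h e = (\<Sum>s\<leftarrow>S. weight h (s * e))"

definition admissible :: "(int \<times> int) list \<Rightarrow> int \<Rightarrow> bool" where
  "admissible h D \<longleftrightarrow> (\<forall>(d, c)\<in>set h. 0 < d \<and> d dvd D)"

fun divisors :: "int list \<Rightarrow> int list" where
  "divisors [] = [1]"
| "divisors (p # ps) = remdups (divisors ps @ map ((*) p) (divisors ps))"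

lemma mem_divisors:
  assumes "\<forall>p\<in>set ps. prime p" "0 < e" "e dvd prod_list ps"
  shows "e \<in> set (divisors ps)"
  using assms
proof (induction ps arbitrary: e)
  case (Cons p ps)
  show ?case
  proof (cases "p dvd e")
    case True
    then obtain f where f: "e = p * f" by blast
    have "0 < p" using Cons.prems by (simp add: prime_gt_0_int)
    then have "f \<in> set (divisors ps)"
      using Cons f by (auto simp: zero_less_mult_iff)
    then show ?thesis by (auto simp: f)
  next
    case False
    then have "coprime e p"
      using Cons.prems prime_imp_coprime[of p e] by (simp add: coprime_commute)
    then show ?thesis
      using Cons by (simp add: coprime_dvd_mult_right_iff)
  qed
qed auto

text \<open>Every \<open>d\<close> in \<open>h\<close> divides \<open>s * D\<close>, so it divides
  \<open>s * b\<close> iff it divides \<open>s * gcd b D\<close>. Thus only finitely many types of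
  \<open>b\<close> occur, and a certificate can be checked without knowing \<open>m\<close>.\<close>

lemma weight_gcd:
  assumes "admissible h D"
  shows "weight h (s * gcd b D) = weight h (s * b)"
  unfolding weight_def
proof (rule arg_cong[of _ _ sum_list], rule map_cong[OF refl], clarify)
  fix d c assume "(d, c) \<in> set h"
  then have "d dvd s * D" using assms by (auto simp: admissible_def)
  then have "d dvd s * gcd b D \<longleftrightarrow> d dvd s * b"
    by (metis gcd_dvd1 gcd_greatest gcd_mult_distrib_int dvd_abs_iff abs_dvd_iff dvd_refl dvd_trans
         abs_mult abs_gcd_int)
  then show "(if d dvd s * gcd b D then c else 0) = (if d dvd s * b then c else 0)" by simp
qed

lemma row_weight_gcd: "admissible h D \<Longrightarrow> row_weight S h (gcd b D) = row_weight S h b"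
  by (simp add: row_weight_def weight_gcd)

context perfect_splitting
begin

lemma set_multipliers: "set (multipliers k1 k2) = S" and distinct_multipliers: "distinct (multipliers k1 k2)"
  by (auto simp: multipliers_def S_def)

lemma sum_weight:
  assumes "m = D * x" "0 < D" "admissible h D"
  shows "(\<Sum>b\<in>B. \<Sum>s\<in>S. weight h (s * b)) = total h D * x - (\<Sum>(d, c)\<leftarrow>h. c)"
  using assms(3)
proof (induction h)
  case (Cons a h)
  obtain d c where a: "a = (d, c)" by force
  with Cons have d: "0 < d" "d dvd D" "admissible h D" by (auto simp: admissible_def)
  then have "d dvd m" using assms(1) by simp
  have "(\<Sum>b\<in>B. \<Sum>s\<in>S. if d dvd s * b then c else 0)
      = c * (\<Sum>b\<in>B. \<Sum>s\<in>S. if d dvd s * b then 1 else 0)"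
    by (simp add: sum_distrib_left if_distrib cong: if_cong)
  also have "\<dots> = c * (D div d * x - 1)"
    using d by (simp add: sum_dvd \<open>d dvd m\<close>) (simp add: assms(1) div_mult_swap mult.commute)
  finally show ?case
    using Cons.IH[OF d(3)] by (simp add: a weight_def total_def sum.distrib algebra_simps)
qed (simp add: weight_def total_def)

lemma sum_row_weight:
  assumes "m = D * x" "0 < D" "admissible h D"
  shows "(\<Sum>b\<in>B. row_weight (multipliers k1 k2) h (gcd b D)) = total h D * x - (\<Sum>(d, c)\<leftarrow>h. c)"
  unfolding row_weight_gcd[OF assms(3)]
  using sum_weight[OF assms] distinct_multipliers
  by (simp add: row_weight_def sum_list_distinct_conv_sum_set set_multipliers)

lemma row_weight_dvd:
  assumes "m = D * x" "0 < D" "admissible h D" "D = prod_list ps" "\<forall>p\<in>set ps. prime p"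
    and "\<forall>e\<in>set (divisors ps). r dvd row_weight (multipliers k1 k2) h e"
  shows "r dvd total h D * x - (\<Sum>(d, c)\<leftarrow>h. c)"
  unfolding sum_row_weight[OF assms(1-3), symmetric]
  using assms by (intro dvd_sum) (simp add: mem_divisors)

lemma row_weight_nonneg:
  assumes "m = D * x" "0 < D" "admissible h D" "D = prod_list ps" "\<forall>p\<in>set ps. prime p"
    and "\<forall>e\<in>set (divisors ps). 0 \<le> row_weight (multipliers k1 k2) h e"
  shows "0 \<le> total h D * x - (\<Sum>(d, c)\<leftarrow>h. c)"
  unfolding sum_row_weight[OF assms(1-3), symmetric]
  using assms by (intro sum_nonneg) (simp add: mem_divisors)

end

text \<open>
  A certificate proves that \<open>m = D x\<close> is impossible or of an allowed form, where no element of the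
  list \<open>cl\<close> divides \<open>x\<close>. A list of pairs \<open>(d, c)\<close> stands for the function \<open>h(y) = \<Sum> c [d | y]\<close>. Summing
  \<open>h(s b)\<close> over all \<open>s\<close> and \<open>b\<close> gives a known value; \<open>Negative\<close> is used when that value is negative although
  each \<open>b\<close> contributes a nonnegative amount, and \<open>Factor r\<close> when each contribution is divisible by \<open>r\<close>,
  which forces a factor of \<open>x\<close>.
\<close>

datatype cert =
    Done
  | Power int
  | Negative "int list" "(int \<times> int) list"
  | Factor int "int list" "(int \<times> int) list" cert
  | Split int cert cert

definition small_primes :: "int list" where
  "small_primes = [2, 3, 5, 7, 11, 13]"

definition valid_weight :: "int \<Rightarrow> int list \<Rightarrow> (int \<times> int) list \<Rightarrow> bool" where
  "valid_weight D ps h \<longleftrightarrow>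
    list_all (\<lambda>p. p \<in> set small_primes) ps \<and> prod_list ps dvd D \<and>
    list_all (\<lambda>(d, c). 0 < d \<and> d dvd prod_list ps) h"

text \<open>In \<open>Negative\<close>, \<open>H * x\<close> minus the coefficient sum is largest at
  \<open>x = 1\<close> because \<open>H \<le> 0\<close>. In \<open>Factor\<close>, with the same
  \<open>H\<close>, \<open>r dvd H * x\<close> forces \<open>n dvd x\<close>, and \<open>n\<close>
  moves into the known part \<open>D\<close>. The bound \<open>p ^ 5\<close> serves to express that
  \<open>D\<close> is a power of \<open>p\<close>.\<close>

fun check :: "int \<Rightarrow> int list \<Rightarrow> int list \<Rightarrow> int list \<Rightarrow> int \<Rightarrow> int list \<Rightarrow> cert \<Rightarrow> bool" where
  "check k S Ms Ps D cl Done \<longleftrightarrow>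
    list_all (\<lambda>p. p \<in> set cl) small_primes \<and> (D \<in> set Ms \<or> \<not> k dvd D - 1)"
| "check k S Ms Ps D cl (Power p) \<longleftrightarrow>
    list_all (\<lambda>q. q = p \<or> q \<in> set cl) small_primes \<and>
    p \<in> set small_primes \<and> D dvd p ^ 5 \<and> p \<in> set Ps"
| "check k S Ms Ps D cl (Negative ps h) \<longleftrightarrow>
    (let H = D div prod_list ps * total h (prod_list ps)
     in valid_weight D ps h \<and> H \<le> 0 \<and> H < (\<Sum>(d, c)\<leftarrow>h. c) \<and>
        list_all (\<lambda>e. 0 \<le> row_weight S h e) (divisors ps))"
| "check k S Ms Ps D cl (Factor r ps h t) \<longleftrightarrow>
    (let n = r div gcd r (D div prod_list ps * total h (prod_list ps))
     in valid_weight D ps h \<and> (\<Sum>(d, c)\<leftarrow>h. c) = 0 \<and> 0 < r \<and>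
        list_all (\<lambda>e. r dvd row_weight S h e) (divisors ps) \<and>
        (list_ex (\<lambda>p. p dvd n) cl \<or> check k S Ms Ps (n * D) cl t))"
| "check k S Ms Ps D cl (Split p t u) \<longleftrightarrow>
    0 < p \<and> (p \<in> set cl \<or> check k S Ms Ps (p * D) cl t) \<and> check k S Ms Ps D (p # cl) u"

lemma prime_small_primes: "p \<in> set small_primes \<Longrightarrow> prime p"
  by (auto simp: small_primes_def)

lemma prime_le_14:
  assumes "prime (p :: int)" "p \<le> 14"
  shows "p \<in> set small_primes"
proof -
  have "2 \<le> p" using assms(1) by (rule prime_ge_2_int)
  with assms(2) have "p = 2 \<or> p = 3 \<or> p = 4 \<or> p = 5 \<or> p = 6 \<or> p = 7 \<or> p = 8 \<or> p = 9
      \<or> p = 10 \<or> p = 11 \<or> p = 12 \<or> p = 13 \<or> p = 14"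
    by presburger
  then show ?thesis using assms(1) by (auto simp: small_primes_def)
qed

lemma div_gcd_dvd:
  fixes r c x :: int
  assumes "r dvd c * x" "0 < r"
  shows "r div gcd r c dvd x"
proof -
  have "coprime (r div gcd r c) (c div gcd r c)"
    using assms by (intro div_gcd_coprime) auto
  moreover have "r div gcd r c * gcd r c dvd (c div gcd r c * x) * gcd r c"
    using assms by (simp add: mult.commute mult.left_commute)
  then have "r div gcd r c dvd c div gcd r c * x"
    using assms(2) by (simp only: dvd_mult_cancel_right) auto
  ultimately show ?thesis by (simp add: coprime_dvd_mult_right_iff)
qed

lemma power_of_only_prime_divisor:
  fixes n p :: int
  assumes "0 < n" "\<And>q. prime q \<Longrightarrow> q dvd n \<Longrightarrow> q = p"
  shows "\<exists>a. n = p ^ a"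
  using assms
proof (induction "nat n" arbitrary: n rule: less_induct)
  case less
  show ?case
  proof (cases "n = 1")
    case True
    then have "n = p ^ 0" by simp
    then show ?thesis ..
  next
    case False
    then obtain q where "prime q" "q dvd n"
      using prime_divisor_exists[of n] less.prems(1) by auto
    with less.prems have q: "prime p" "p dvd n" by auto
    then obtain y where y: "n = p * y" by blast
    have "1 < p" using q(1) by (rule prime_gt_1_int)
    with y less.prems(1) have "0 < y" "y < n"
      by (simp_all add: zero_less_mult_iff)
    then obtain a where "y = p ^ a"
      using less.hyps[of y] less.prems y by auto
    with y have "n = p ^ Suc a" by simp
    then show ?thesis ..
  qed
qed

context perfect_splitting
begin

lemma check_sound:
  assumes "check (k1 + k2) (multipliers k1 k2) Ms Ps D cl t"
    and "m = D * x" "0 < D"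
    and "\<forall>p\<in>set cl. \<not> p dvd x"
    and small: "\<And>p. prime p \<Longrightarrow> p dvd m \<Longrightarrow> p \<in> set small_primes"
  shows "m \<in> set Ms \<or> (\<exists>p\<in>set Ps. \<exists>a. m = p ^ a)"
  using assms(1-4)
proof (induction t arbitrary: D cl x)
  case Done
  have x: "0 < x" using Done m_pos by (simp add: zero_less_mult_iff)
  have "x = 1"
  proof (rule ccontr)
    assume "x \<noteq> 1"
    then obtain q where "prime q" "q dvd x"
      using prime_divisor_exists[of x] x by auto
    then show False
      using small[of q] Done by (auto simp: list_all_iff)
  qed
  moreover have "k1 + k2 dvd m - 1"
    unfolding card_B[symmetric] by simp
  ultimately show ?case using Done by auto
next
  case (Power p)
  have "q = p" if "prime q" "q dvd m" for q
  proof (rule ccontr)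
    assume "q \<noteq> p"
    with that Power small have "\<not> q dvd x" by (auto simp: list_all_iff)
    with that Power(2) have "q dvd D" by (simp add: prime_dvd_mult_iff)
    with Power have "q dvd p ^ 5" by auto
    with that have "q dvd p" by (metis prime_dvd_power)
    moreover have "prime p"
      using Power prime_small_primes by simp
    ultimately show False
      using \<open>prime q\<close> \<open>q \<noteq> p\<close> by (simp add: primes_dvd_imp_eq)
  qed
  then have "\<exists>a. m = p ^ a"
    by (rule power_of_only_prime_divisor[OF m_pos])
  then show ?case using Power(1) by auto
next
  case (Negative ps h)
  define P where "P = prod_list ps"
  have ok: "valid_weight D ps h" "D div P * total h P \<le> 0"
    "D div P * total h P < (\<Sum>(d, c)\<leftarrow>h. c)"
    "\<forall>e\<in>set (divisors ps). 0 \<le> row_weight (multipliers k1 k2) h e"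
    using Negative.prems(1) by (simp_all add: Let_def list_all_iff P_def)
  have x: "0 < x" using Negative m_pos by (simp add: zero_less_mult_iff)
  have primes: "\<forall>p\<in>set ps. prime p"
    using ok(1) prime_small_primes by (auto simp: valid_weight_def list_all_iff)
  have D: "D = P * (D div P)"
    using ok(1) by (simp add: valid_weight_def P_def)
  have "0 < P"
    unfolding P_def using primes by (induction ps) (auto simp: prime_gt_0_int)
  have "0 \<le> total h P * (D div P * x) - (\<Sum>(d, c)\<leftarrow>h. c)"
    using Negative.prems(2) D \<open>0 < P\<close> ok primes
    by (intro row_weight_nonneg[where ps = ps])
       (auto simp: P_def valid_weight_def admissible_def list_all_iff mult.assoc[symmetric])
  moreover have "D div P * total h P * x \<le> D div P * total h P * 1"
    using ok(2) x by (intro mult_left_mono_neg) auto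
  ultimately show ?case using ok(3) by (simp add: algebra_simps)
next
  case (Factor r ps h t)
  define P where "P = prod_list ps"
  define n where "n = r div gcd r (D div P * total h P)"
  have ok: "valid_weight D ps h" "(\<Sum>(d, c)\<leftarrow>h. c) = 0" "0 < r"
    "\<forall>e\<in>set (divisors ps). r dvd row_weight (multipliers k1 k2) h e"
    "(\<exists>p\<in>set cl. p dvd n) \<or> check (k1 + k2) (multipliers k1 k2) Ms Ps (n * D) cl t"
    using Factor.prems(1) by (auto simp: Let_def list_all_iff list_ex_iff P_def n_def)
  have primes: "\<forall>p\<in>set ps. prime p"
    using ok(1) prime_small_primes by (auto simp: valid_weight_def list_all_iff)
  have D: "D = P * (D div P)"
    using ok(1) by (simp add: valid_weight_def P_def)
  have "0 < P"
    unfolding P_def using primes by (induction ps) (auto simp: prime_gt_0_int)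
  have "r dvd total h P * (D div P * x) - (\<Sum>(d, c)\<leftarrow>h. c)"
    using Factor.prems(2) D \<open>0 < P\<close> ok primes
    by (intro row_weight_dvd[where ps = ps])
       (auto simp: P_def valid_weight_def admissible_def list_all_iff mult.assoc[symmetric])
  then have "r dvd D div P * total h P * x"
    using ok(2) by (simp add: algebra_simps)
  then have "n dvd x"
    unfolding n_def using ok(3) by (intro div_gcd_dvd)
  then obtain y where y: "x = n * y" by blast
  have "0 < n"
    using ok(3) unfolding n_def by (simp add: pos_imp_zdiv_pos_iff zdvd_imp_le)
  have "\<not> (\<exists>p\<in>set cl. p dvd n)"
    using Factor.prems(4) \<open>n dvd x\<close> dvd_trans by blast
  then have "check (k1 + k2) (multipliers k1 k2) Ms Ps (n * D) cl t"
    using ok(5) by simp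
  then show ?case
    using Factor.prems y \<open>0 < n\<close> by (intro Factor.IH[of "n * D" cl y]) auto
next
  case (Split p t u)
  show ?case
  proof (cases "p dvd x")
    case True
    then obtain y where "x = p * y" by blast
    then show ?thesis
      using Split.prems by (intro Split.IH(1)[of "p * D" cl y]) auto
  next
    case False
    then show ?thesis
      using Split.prems by (intro Split.IH(2)[of D "p # cl" x]) auto
  qed
qed

end

subsection \<open>Certificates for all multiplier intervals\<close>

text \<open>The certificates were found by a computer search.\<close>

abbreviation Coprime_factor :: "int \<Rightarrow> int \<Rightarrow> cert \<Rightarrow> cert" where
  "Coprime_factor r p \<equiv> Factor r [p] [(1, 1), (p, -1)]"

definition certificates :: "((int \<times> int) list \<times> cert) list" where
  "certificates = [
   ([(0, 4), (1, 3)],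
    Power 3),
   ([(2, 2)],
    Done),
   ([(0, 5), (1, 4)],
    Split 2
      (Coprime_factor 3 2 (Split 3
          (Negative [2, 3, 3] [(1, -1), (2, 1), (3, 3), (6, -3), (9, -2), (18, 2)])
          (Split 2
            (Factor 9 [2, 2] [(1, -1), (2, 4), (4, -3)] Done)
            Done)))
      (Split 3
        (Coprime_factor 4 3 Done)
        Done)),
   ([(2, 3)],
    Split 2
      (Coprime_factor 3 2 (Split 2
          (Negative [2, 2] [(1, -2), (2, 5), (4, -3)])
          (Split 3
            (Factor 16 [3, 3] [(1, -1), (3, 5), (9, -4)] Done)
            Done)))
      (Split 3
        (Coprime_factor 4 3 Done)
        Done)),
   ([(2, 4), (3, 3)],
    Done),
   ([(0, 6), (1, 5)],
    Power 5),
   ([(0, 7), (1, 6), (3, 4)],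
    Split 3
      (Coprime_factor 5 3 (Split 2
          (Negative [2, 5] [(1, -1), (2, 1), (5, 4), (10, -4)])
          (Split 3
            (Negative [3, 3] [(1, -2), (3, 7), (9, -5)])
            (Split 5
              (Factor 36 [5, 5] [(1, -1), (5, 7), (25, -6)] Done)
              Done))))
      (Split 5
        (Coprime_factor 6 5 Done)
        (Power 2))),
   ([(2, 5)],
    Split 3

        (Coprime_factor 6 3
          (Factor 36 [3, 3] [(1, -1), (3, 7), (9, -6)]
            (Negative [2, 3, 3] [(1, -6), (2, 7), (3, 21), (6, -28), (9, -42), (18, 84)])))
      (Split 5
        (Coprime_factor 6 5 Done)
        (Power 2))),
   ([(2, 6), (3, 5), (4, 4)],
    Split 5
      (Coprime_factor 7 5 Done)
      (Power 3)),
   ([(0, 8), (1, 7)],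
    Split 5

        (Coprime_factor 7 5
          (Coprime_factor 7 7
            (Negative [5, 7, 7] [(1, -1), (5, 1), (7, 7), (35, -7), (49, -6), (245, 6)])))
      (Split 3
        (Coprime_factor 6 3 (Split 7
            (Factor 5 [3, 7] [(1, 1), (3, -1), (7, -1), (21, 1)] Done)
            (Power 3)))
        (Power 7))),
   ([(0, 9), (1, 8), (4, 5)],
    Split 7
      (Coprime_factor 8 7 (Negative [2, 7] [(1, -1), (2, 1), (7, 5), (14, -5)]))
      (Split 2
        (Coprime_factor 5 2 (Split 5
            (Negative [2, 5, 5] [(1, -1), (2, 1), (5, 5), (10, -5), (25, -4), (50, 4)])
            (Split 2
              (Factor 25 [2, 2] [(1, -2), (2, 7), (4, -5)] Done)
              Done)))
        (Split 5
          (Coprime_factor 8 5 Done)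
          Done))),
   ([(2, 7), (3, 6)],
    Split 7
      (Coprime_factor 8 7 (Negative [2, 2] [(1, -3), (2, 8), (4, -5)]))
      (Split 2
        (Coprime_factor 5 2 (Split 2
            (Negative [2, 2] [(1, -3), (2, 8), (4, -5)])
            (Split 5
              (Factor 64 [5, 5] [(1, -1), (5, 9), (25, -8)] Done)
              Done)))
        (Split 5
          (Coprime_factor 8 5 Done)
          Done))),
   ([(0, 10), (1, 9), (4, 6)],
    Split 3
      (Coprime_factor 7 3 (Split 7
          (Negative [3, 7, 7] [(1, -1), (3, 1), (7, 7), (21, -7), (49, -6), (147, 6)])
          (Split 3
            (Factor 49 [3, 3] [(1, -2), (3, 9), (9, -7)] Done)
            Done)))
      (Split 7
        (Coprime_factor 9 7 Done)
        Done)),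
   ([(2, 8), (5, 5)],
    Split 3
      (Coprime_factor 8 3 Done)
      (Split 7
        (Coprime_factor 9 7 Done)
        Done)),
   ([(3, 7)],
    Split 3
      (Coprime_factor 7 3 (Split 3
          (Negative [3, 3] [(1, -3), (3, 10), (9, -7)])
          (Split 7
            (Factor 81 [7, 7] [(1, -1), (7, 10), (49, -9)] Done)
            Done)))
      (Split 7
        (Coprime_factor 9 7 Done)
        Done)),
   ([(0, 11), (1, 10)],
    Split 5
      (Coprime_factor 9 5 (Negative [3, 5] [(1, -1), (3, 1), (5, 4), (15, -4)]))
      (Split 7
        (Coprime_factor 10 7 Done)
        (Split 2
          (Coprime_factor 6 2 (Split 3
              (Negative [2, 3, 3] [(1, -1), (2, 1), (3, -3), (6, 3), (9, 12), (18, -12)])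
              (Split 2
                (Factor 72 [2, 2, 2] [(1, 1), (2, -7), (4, 18), (8, -12)] Done)
                Done)))
          (Split 3
            (Coprime_factor 8 3 Done)
            Done)))),
   ([(5, 6)],
    Split 5
      (Coprime_factor 9 5 (Negative [3, 3] [(1, -3), (3, 11), (9, -8)]))
      (Split 2
        (Coprime_factor 6 2 (Split 2
            (Negative [2, 2, 2, 3] [(1, -1), (2, -1), (3, 1), (4, 6), (6, 1), (8, -4), (12, -6), (24, 4)])
            (Split 3
              (Negative [3, 3] [(1, -3), (3, 11), (9, -8)])
              Done)))
        (Split 3
          (Coprime_factor 8 3 Done)
          Done))),
   ([(3, 8)],
    Split 5

        (Coprime_factor 10 5
          (Factor 100 [5, 5] [(1, -1), (5, 11), (25, -10)]
            (Factor 1000 [5, 5, 5] [(1, 1), (5, -11), (25, 110), (125, -100)]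
              (Negative [2, 5, 5, 5] [(1, -7), (2, 8), (5, 37), (10, -48), (25, -130), (50, 240), (125, 100), (250, -200)]))))
      (Split 7
        (Coprime_factor 10 7 Done)
        (Split 2
          (Coprime_factor 6 2 (Split 3
              (Negative [3, 3] [(1, -3), (3, 11), (9, -8)])
              (Split 2
                (Factor 72 [2, 2, 2] [(1, 1), (2, -7), (4, 18), (8, -12)] Done)
                Done)))
          (Split 3
            (Coprime_factor 8 3 Done)
            Done)))),
   ([(4, 7)],
    Split 5

        (Coprime_factor 10 5
          (Factor 100 [5, 5] [(1, -1), (5, 11), (25, -10)]
            (Factor 1000 [5, 5, 5] [(1, 1), (5, -11), (25, 110), (125, -100)]
              (Negative [2, 5, 5, 5] [(1, -7), (2, 8), (5, 37), (10, -48), (25, -130), (50, 240), (125, 100), (250, -200)]))))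
      (Split 7
        (Coprime_factor 10 7 Done)
        (Split 2
          (Coprime_factor 6 2 (Split 2
              (Negative [2, 2, 2, 3] [(1, -1), (2, -1), (3, 1), (4, 6), (6, 1), (8, -4), (12, -6), (24, 4)])
              (Split 3
                (Negative [3, 3] [(1, -3), (3, 11), (9, -8)])
                Done)))
          (Split 3
            (Coprime_factor 8 3 Done)
            Done)))),
   ([(2, 9)],
    Split 5

        (Coprime_factor 10 5
          (Factor 100 [5, 5] [(1, -1), (5, 11), (25, -10)]
            (Factor 1000 [5, 5, 5] [(1, 1), (5, -11), (25, 110), (125, -100)]
              (Negative [2, 5, 5, 5] [(1, -7), (2, 8), (5, 37), (10, -48), (25, -130), (50, 240), (125, 100), (250, -200)]))))
      (Split 7
        (Coprime_factor 10 7 Done)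
        (Split 2
          (Coprime_factor 6 2 (Split 3
              (Negative [2, 3, 3] [(1, -1), (2, 1), (3, -3), (6, 3), (9, 12), (18, -12)])
              (Split 2
                (Factor 72 [2, 2, 2] [(1, 1), (2, -7), (4, 18), (8, -12)] Done)
                Done)))
          (Split 3
            (Coprime_factor 8 3 Done)
            Done)))),
   ([(2, 10), (5, 7), (6, 6)],
    Split 7
      (Coprime_factor 11 7 Done)
      (Power 5)),
   ([(3, 9), (4, 8)],
    Split 5
      (Coprime_factor 11 5 Done)
      (Split 7
        (Coprime_factor 11 7 Done)
        Done)),
   ([(0, 12), (1, 11)],
    Split 7

        (Coprime_factor 11 7
          (Coprime_factor 11 11
            (Negative [7, 11, 11] [(1, -1), (7, 1), (11, 11), (77, -11), (121, -10), (847, 10)])))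
      (Split 5
        (Coprime_factor 10 5 (Split 11
            (Factor 9 [5, 11] [(1, 1), (5, -1), (11, -1), (55, 1)] Done)
            (Power 5)))
        (Power 11))),
   ([(0, 13), (1, 12)],
    Split 11
      (Coprime_factor 12 11 (Negative [2, 11] [(1, -1), (2, 1), (11, 7), (22, -7)]))
      (Split 5
        (Coprime_factor 11 5 Done)
        (Split 2
          (Coprime_factor 7 2 (Split 3
              (Factor 5 [2, 3] [(1, 1), (2, -1), (3, -1), (6, 1)] Done)
              (Split 7
                (Negative [2, 7, 7] [(1, -1), (2, 1), (7, 7), (14, -7), (49, -6), (98, 6)])
                (Split 2
                  (Factor 49 [2, 2] [(1, -3), (2, 10), (4, -7)] Done)
                  Done))))
          (Split 7
            (Coprime_factor 12 7 Done)
            (Power 3))))),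
   ([(5, 8)],
    Split 5
      (Coprime_factor 11 5 Done)
      (Split 3
        (Coprime_factor 10 3 Done)
        (Split 2
          (Coprime_factor 7 2 (Split 7
              (Negative [2, 7, 7] [(1, -1), (2, 1), (7, 7), (14, -7), (49, -6), (98, 6)])
              (Split 2
                (Factor 49 [2, 2] [(1, -3), (2, 10), (4, -7)] Done)
                Done)))
          (Split 7
            (Coprime_factor 12 7 Done)
            Done)))),
   ([(3, 10)],
    Split 5
      (Coprime_factor 11 5 Done)
      (Split 2
        (Coprime_factor 7 2 (Split 2
            (Negative [2, 2] [(1, -4), (2, 11), (4, -7)])
            (Split 3
              (Factor 4 [2, 3] [(1, 1), (2, -1), (3, -1), (6, 1)] Done)
              (Split 7
                (Negative [2, 7, 7] [(1, -1), (2, 1), (7, 7), (14, -7), (49, -6), (98, 6)])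
                Done))))
        (Split 7
          (Coprime_factor 12 7 Done)
          (Power 3)))),
   ([(6, 7)],
    Split 3
      (Coprime_factor 9 3 (Negative [3, 3] [(1, -4), (3, 13), (9, -9)]))
      (Split 5
        (Coprime_factor 11 5 Done)
        (Split 2
          (Coprime_factor 7 2 (Split 2
              (Negative [2, 2] [(1, -4), (2, 11), (4, -7)])
              (Split 7
                (Negative [2, 7, 7] [(1, -1), (2, 1), (7, 7), (14, -7), (49, -6), (98, 6)])
                Done)))
          (Split 7
            (Coprime_factor 12 7 Done)
            Done)))),
   ([(4, 9)],
    Split 5

        (Coprime_factor 12 5
          (Coprime_factor 9 3
            (Negative [3, 3, 5] [(1, -3), (3, 11), (5, 3), (9, -8), (15, -11), (45, 8)])))
      (Split 2
        (Coprime_factor 7 2 (Split 3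
            (Negative [2, 3] [(1, -5), (2, 9), (3, 5), (6, -9)])
            (Split 7
              (Negative [2, 7, 7] [(1, -1), (2, 1), (7, 7), (14, -7), (49, -6), (98, 6)])
              (Split 2
                (Factor 49 [2, 2] [(1, -3), (2, 10), (4, -7)] Done)
                Done))))
        (Split 7
          (Coprime_factor 12 7 Done)
          (Power 3)))),
   ([(2, 11)],
    Split 11

        (Coprime_factor 12 11
          (Negative [2, 3, 11] [(1, -5), (2, 9), (3, 5), (6, -9), (11, 5), (22, -9), (33, -5), (66, 9)]))
      (Split 5
        (Coprime_factor 11 5 Done)
        (Split 3
          (Coprime_factor 10 3 Done)
          (Split 2
            (Coprime_factor 7 2 (Split 2
                (Negative [2, 2] [(1, -4), (2, 11), (4, -7)])
                (Split 7
                  (Negative [2, 7, 7] [(1, -1), (2, 1), (7, 7), (14, -7), (49, -6), (98, 6)])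
                  Done)))
            (Split 7
              (Coprime_factor 12 7 Done)
              Done))))),
   ([(2, 12), (3, 11), (4, 10), (5, 9), (6, 8), (7, 7)],
    Split 11
      (Coprime_factor 13 11 Done)
      (Split 3
        (Coprime_factor 10 3 (Split 3
            (Negative [3, 3, 5] [(1, -3), (3, 11), (5, 3), (9, -8), (15, -11), (45, 8)])
            (Split 5
              (Factor 72 [5, 5] [(1, -1), (5, 7), (25, -6)] Done)
              Done)))
        (Split 5
          (Coprime_factor 12 5 Done)
          Done))),
   ([(0, 14), (1, 13)],
    Split 11

        (Coprime_factor 13 11
          (Coprime_factor 13 13
            (Negative [11, 13, 13] [(1, -1), (11, 1), (13, 13), (143, -13), (169, -12), (1859, 12)])))
      (Split 3
        (Coprime_factor 10 3 (Split 3
            (Negative [3, 3, 5] [(1, -3), (3, 11), (5, 3), (9, -8), (15, -11), (45, 8)])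
            (Split 5
              (Factor 72 [5, 5] [(1, -1), (5, 7), (25, -6)] Done)
              (Split 13
                (Factor 9 [3, 13] [(1, 1), (3, -1), (13, -1), (39, 1)] Done)
                Done))))
        (Split 5
          (Coprime_factor 12 5 Done)
          (Power 13))))]"

text \<open>For these \<open>m\<close>, all equal to \<open>2 * (k1 + k2) + 1\<close>, a set of two
  units would satisfy every divisor count, so only an exhaustive search rules them out.\<close>

definition exceptional_orders :: "(int \<times> int \<times> int) list" where
  "exceptional_orders = [(1, 6, 15), (1, 9, 21), (3, 7, 21)]"

text \<open>The families are \<open>k1 + k2 = p + 1\<close>, then 7 at \<open>p = 2\<close>, 8 at
  \<open>p = 3\<close>, 12 at \<open>p = 5\<close> and 13 at \<open>p = 3\<close>. In each,
  \<open>k1 + k2\<close> divides some \<open>p ^ r - 1\<close> with \<open>r > 0\<close>, so the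
  condition on \<open>m - 1\<close> permits infinitely many exponents.\<close>

definition prime_power_cases :: "(int \<times> int \<times> int) list" where
  "prime_power_cases =
    [(0, 4, 3), (1, 3, 3), (0, 6, 5), (1, 5, 5), (0, 8, 7), (1, 7, 7),
     (0, 12, 11), (1, 11, 11), (0, 14, 13), (1, 13, 13),
     (0, 7, 2), (1, 6, 2), (2, 5, 2), (3, 4, 2),
     (0, 8, 3), (1, 7, 3), (2, 6, 3), (3, 5, 3), (4, 4, 3),
     (0, 12, 5), (1, 11, 5), (2, 10, 5), (5, 7, 5), (6, 6, 5),
     (0, 13, 3), (1, 12, 3), (3, 10, 3), (4, 9, 3)]"

definition select :: "(int \<times> int \<times> int) list \<Rightarrow> int \<Rightarrow> int \<Rightarrow> int list" where
  "select xs k1 k2 = map (\<lambda>(a, b, c). c) (filter (\<lambda>(a, b, c). a = k1 \<and> b = k2) xs)"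

definition allowed_orders :: "int \<Rightarrow> int \<Rightarrow> int list" where
  "allowed_orders k1 k2 = [1, k1 + k2 + 1] @ (if k1 = 0 then [2 * k2 + 1] else [])
     @ select exceptional_orders k1 k2"

text \<open>The initial list holds known non-divisors of \<open>m\<close>: a prime factor of
  \<open>k1 + k2\<close> is prime to \<open>m\<close> since \<open>k1 + k2\<close> divides
  \<open>m - 1\<close>, and pure singularity excludes primes above \<open>k2\<close>.\<close>

definition check_pair :: "int \<Rightarrow> int \<Rightarrow> cert \<Rightarrow> bool" where
  "check_pair k1 k2 = check (k1 + k2) (multipliers k1 k2) (allowed_orders k1 k2)
     (select prime_power_cases k1 k2) 1 (filter (\<lambda>p. p dvd k1 + k2 \<or> k2 < p) small_primes)"

lemma certificates_correct:
  "list_all (\<lambda>(ks, t). list_all (\<lambda>(k1, k2). check_pair k1 k2 t) ks) certificates"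
  by code_simp

lemma certificates_complete:
  "list_all (\<lambda>k1. list_all (\<lambda>k2. k1 \<le> k2 \<longrightarrow> 4 \<le> k1 + k2 \<longrightarrow> k1 + k2 \<le> 14 \<longrightarrow>
     list_ex (\<lambda>(ks, t). (k1, k2) \<in> set ks) certificates) [2..14]) [0..7]"
  by code_simp

subsection \<open>The Frobenius map of a group ring\<close>

text \<open>The action on \<open>f\<close> of the \<open>n\<close>-th power of the group ring
  element formed by the \<open>t i\<close>: the operator taking \<open>f\<close> to the function
  \<open>\<Sum>i\<in>I. f (t i * g)\<close> of \<open>g\<close>, iterated. Operators on functions of
  integers stand in for the group ring.\<close>

primrec power_sum :: "nat \<Rightarrow> 'i set \<Rightarrow> ('i \<Rightarrow> int) \<Rightarrow> (int \<Rightarrow> int) \<Rightarrow> int \<Rightarrow> int" where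
  "power_sum 0 I t f g = f g"
| "power_sum (Suc n) I t f g = (\<Sum>i\<in>I. power_sum n I t f (t i * g))"

text \<open>The binomial theorem for two commuting operators, the one of \<open>t j\<close> and the
  one of \<open>I\<close>.\<close>

lemma power_sum_insert:
  assumes "finite I" "j \<notin> I"
  shows "power_sum n (insert j I) t f g = (\<Sum>i\<le>n. of_nat (n choose i) * power_sum (n - i) I t f (t j ^ i * g))"
proof (induction n arbitrary: g)
  case (Suc n)
  let ?a = "\<lambda>i. power_sum (Suc n - i) I t f (t j ^ i * g)"
  have "power_sum (Suc n) (insert j I) t f g
      = power_sum n (insert j I) t f (t j * g) + (\<Sum>k\<in>I. power_sum n (insert j I) t f (t k * g))"
    using assms by simp
  also have "power_sum n (insert j I) t f (t j * g) = (\<Sum>i\<le>n. of_nat (n choose i) * ?a (Suc i))"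
    by (simp add: Suc mult.assoc mult.left_commute mult.commute)
  also have "(\<Sum>k\<in>I. power_sum n (insert j I) t f (t k * g))
      = (\<Sum>i\<le>n. of_nat (n choose i) * (\<Sum>k\<in>I. power_sum (n - i) I t f (t k * (t j ^ i * g))))"
    unfolding Suc by (subst sum.swap) (simp add: sum_distrib_left mult.left_commute)
  also have "\<dots> = (\<Sum>i\<le>n. of_nat (n choose i) * ?a i)"
    by (intro sum.cong) (simp_all add: Suc_diff_le)
  also have "\<dots> = (\<Sum>i\<le>Suc n. of_nat (n choose i) * ?a i)"
    by simp
  also have "\<dots> = ?a 0 + (\<Sum>i\<le>n. of_nat (n choose Suc i) * ?a (Suc i))"
    by (subst sum.atMost_Suc_shift) simp
  finally show ?case
    by (subst sum.atMost_Suc_shift) (simp add: sum.distrib[symmetric] algebra_simps)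
qed simp

text \<open>When the elements of \<open>I\<close> are added one at a time, the mixed binomial terms
  vanish modulo \<open>p\<close>.\<close>

lemma power_sum_prime:
  assumes "prime p" "finite I"
  shows "[power_sum p I t f g = (\<Sum>i\<in>I. f (t i ^ p * g))] (mod int p)"
  using assms(2)
proof (induction I arbitrary: g)
  case empty
  have "0 < p" using assms(1) by (rule prime_gt_0_nat)
  then show ?case by (cases p) simp_all
next
  case (insert j I)
  let ?a = "\<lambda>i. of_nat (p choose i) * power_sum (p - i) I t f (t j ^ i * g)"
  have "0 < p" using assms(1) by (rule prime_gt_0_nat)
  have "{..p} = insert 0 (insert p {0<..<p})" by auto
  then have "power_sum p (insert j I) t f g = ?a 0 + (?a p + (\<Sum>i\<in>{0<..<p}. ?a i))"
    using insert \<open>0 < p\<close> by (simp add: power_sum_insert)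
  also have "[\<dots> = power_sum p I t f g + (f (t j ^ p * g) + 0)] (mod int p)"
  proof (intro cong_add)
    show "[(\<Sum>i\<in>{0<..<p}. ?a i) = 0] (mod int p)"
      unfolding cong_0_iff using assms(1)
      by (intro dvd_sum dvd_mult2) (simp add: dvd_choose_prime)
  qed simp_all
  also have "[power_sum p I t f g + (f (t j ^ p * g) + 0)
      = (\<Sum>i\<in>I. f (t i ^ p * g)) + (f (t j ^ p * g) + 0)] (mod int p)"
    using insert.IH by (intro cong_add) auto
  finally show ?case using insert by (simp add: add.commute)
qed

lemma power_sum_const:
  assumes "\<And>i. i \<in> I \<Longrightarrow> coprime (t i) q"
    and "\<And>g. coprime g q \<Longrightarrow> [(\<Sum>i\<in>I. f (t i * g)) = c] (mod r)" and "coprime g q"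
  shows "[power_sum (Suc n) I t f g = c * int (card I) ^ n] (mod r)"
  using assms(3)
proof (induction n arbitrary: g)
  case 0
  then show ?case using assms(2) by simp
next
  case (Suc n)
  have "[power_sum (Suc (Suc n)) I t f g = (\<Sum>i\<in>I. c * int (card I) ^ n)] (mod r)"
    unfolding power_sum.simps(2)[of "Suc n"] using Suc assms(1) by (intro cong_sum Suc.IH) simp
  then show ?case by (simp add: mult.left_commute)
qed

text \<open>This is the identity \<open>S\<^sup>p = S\<^bsup>(p)\<^esup>\<close> in a commutative group ring of characteristic \<open>p\<close>,
  iterated, where \<open>S\<^bsup>(p)\<^esup>\<close> consists of the \<open>p\<close>-th powers of the elements of \<open>S\<close>.\<close>

lemma frobenius_sum:
  fixes t :: "'i \<Rightarrow> int"
  assumes "prime p" "finite I" "\<And>i. i \<in> I \<Longrightarrow> coprime (t i) q"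
    and "\<And>g. coprime g q \<Longrightarrow> (\<Sum>i\<in>I. f (t i * g)) = 1" "p dvd card I"
    and "0 < n" "coprime g q"
  shows "int p dvd (\<Sum>i\<in>I. f (t i ^ (p ^ n) * g))"
  using assms(6,7)
proof (induction n arbitrary: g rule: nat_induct_non_zero)
  case 1
  obtain r where r: "p = Suc (Suc r)"
    using prime_ge_2_nat[OF assms(1)] by (metis add_2_eq_Suc le_Suc_ex)
  have "[(\<Sum>i\<in>I. f (t i ^ p * g)) = power_sum p I t f g] (mod int p)"
    using power_sum_prime[OF assms(1,2)] by (rule cong_sym)
  also have "power_sum p I t f g = power_sum (Suc (Suc r)) I t f g"
    by (simp only: r)
  \<comment> \<open>One application gives the constant 1; the other \<open>p - 1 \<ge> 1\<close>
    each contribute a factor \<open>card I\<close>, so at least one such factor is present.\<close>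
  also have "[power_sum (Suc (Suc r)) I t f g = 1 * int (card I) ^ Suc r] (mod int p)"
    using assms 1 by (intro power_sum_const[where q = q]) auto
  also have "[1 * int (card I) ^ Suc r = 0] (mod int p)"
    using assms(5) by (simp add: cong_0_iff)
  finally show ?case by (simp add: cong_0_iff)
next
  case (Suc n)
  obtain r where r: "p = Suc r"
    using prime_gt_0_nat[OF assms(1)] gr0_implies_Suc by blast
  have "[(\<Sum>i\<in>I. f ((t i ^ p ^ n) ^ p * g)) = power_sum p I (\<lambda>i. t i ^ p ^ n) f g] (mod int p)"
    using power_sum_prime[OF assms(1,2)] by (rule cong_sym)
  also have "power_sum p I (\<lambda>i. t i ^ p ^ n) f g = power_sum (Suc r) I (\<lambda>i. t i ^ p ^ n) f g"
    by (simp only: r)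
  also have "[power_sum (Suc r) I (\<lambda>i. t i ^ p ^ n) f g = 0 * int (card I) ^ r] (mod int p)"
    using assms Suc by (intro power_sum_const[where q = q]) (auto simp: cong_0_iff)
  finally have "int p dvd (\<Sum>i\<in>I. f ((t i ^ p ^ n) ^ p * g))"
    by (simp add: cong_0_iff)
  moreover have "(t i ^ p ^ n) ^ p = t i ^ p ^ Suc n" for i
    by (simp only: power_mult[symmetric] power_Suc2)
  ultimately show ?case by simp
qed

text \<open>Lifting the exponent: \<open>u ^ p - v ^ p = (u - v) * Q\<close>, and \<open>Q\<close>
  is congruent to \<open>p * v ^ (p - 1)\<close> modulo \<open>p ^ 2\<close>, so it contributes
  exactly one factor \<open>p\<close>.\<close>

lemma prime_cong_power_iff:
  fixes u v :: int
  assumes p: "prime p" "odd p" and v: "coprime v (int p)" and uv: "[u = v] (mod int p)" and j: "0 < j"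
  shows "[u ^ p = v ^ p] (mod int p ^ Suc j) \<longleftrightarrow> [u = v] (mod int p ^ j)"
proof -
  define Q where "Q = (\<Sum>i<p. v ^ (p - Suc i) * u ^ i)"
  obtain k where k: "u = v + int p * k"
    using uv by (metis cong_iff_lin cong_sym)
  have pow: "[u ^ i = v ^ i + int p * (int i * k * v ^ (i - 1))] (mod int p ^ 2)" for i
  proof (induction i)
    case (Suc i)
    have "[u ^ i * u = (v ^ i + int p * (int i * k * v ^ (i - 1))) * (v + int p * k)] (mod int p ^ 2)"
      using Suc unfolding k by (intro cong_mult) auto
    also have "(v ^ i + int p * (int i * k * v ^ (i - 1))) * (v + int p * k)
        = v ^ Suc i + int p * (int (Suc i) * k * v ^ i) + int p ^ 2 * (int i * k * v ^ (i - 1) * k)"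
      by (cases i) (simp_all add: algebra_simps power2_eq_square)
    also have "[\<dots> = v ^ Suc i + int p * (int (Suc i) * k * v ^ i)] (mod int p ^ 2)"
      by (simp add: cong_iff_dvd_diff)
    finally show ?case by (simp add: mult.commute)
  qed simp
  have "[Q = (\<Sum>i<p. v ^ (p - Suc i) * (v ^ i + int p * (int i * k * v ^ (i - 1))))] (mod int p ^ 2)"
    unfolding Q_def by (intro cong_sum cong_mult pow) auto
  also have "(\<Sum>i<p. v ^ (p - Suc i) * (v ^ i + int p * (int i * k * v ^ (i - 1))))
      = (\<Sum>i<p. v ^ (p - 1) + int p * k * v ^ (p - 2) * int i)"
  proof (intro sum.cong refl)
    fix i assume "i \<in> {..<p}"
    then have "p - Suc i + i = p - 1" "i = 0 \<or> p - Suc i + (i - 1) = p - 2" by auto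
    then have "v ^ (p - 1) = v ^ (p - Suc i) * v ^ i" "i = 0 \<or> v ^ (p - 2) = v ^ (p - Suc i) * v ^ (i - 1)"
      by (metis power_add)+
    then show "v ^ (p - Suc i) * (v ^ i + int p * (int i * k * v ^ (i - 1)))
        = v ^ (p - 1) + int p * k * v ^ (p - 2) * int i"
      by (auto simp: algebra_simps)
  qed
  also have "\<dots> = int p * v ^ (p - 1) + int p * k * v ^ (p - 2) * (\<Sum>i<p. int i)"
    by (simp add: sum.distrib sum_distrib_left)
  \<comment> \<open>Oddness of \<open>p\<close> makes this sum a multiple of \<open>p\<close>, so
    the first-order correction vanishes modulo \<open>p ^ 2\<close>.\<close>
  also have "(\<Sum>i<p. int i) = int p * (int (p - 1) div 2)"
  proof -
    have "2 * (\<Sum>i<Suc n. int i) = int (Suc n) * int n" for n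
      by (induction n) (auto simp: algebra_simps)
    from this[of "p - 1"] show ?thesis using p(2) by (auto elim!: oddE)
  qed
  also have "[int p * v ^ (p - 1) + int p * k * v ^ (p - 2) * (int p * (int (p - 1) div 2))
      = int p * v ^ (p - 1)] (mod int p ^ 2)"
    by (simp add: cong_iff_dvd_diff power2_eq_square)
  finally have Q: "[Q = int p * v ^ (p - 1)] (mod int p ^ 2)" .
  then obtain l where l: "Q = int p * v ^ (p - 1) + int p ^ 2 * l"
    by (metis cong_iff_lin cong_sym)
  define R where "R = v ^ (p - 1) + int p * l"
  have QR: "Q = int p * R"
    by (simp add: l R_def algebra_simps power2_eq_square)
  have "coprime (v ^ (p - 1)) (int p)" using v by simp
  then have "gcd (int p) (l * int p + v ^ (p - 1)) = 1"
    by (simp only: gcd_add_mult coprime_iff_gcd_eq_1 gcd.commute)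
  then have R: "coprime (int p) R"
    by (simp add: R_def coprime_iff_gcd_eq_1 add.commute mult.commute)
  have "u ^ p - v ^ p = int p * ((u - v) * R)"
    using power_diff_sumr2[of u p v] QR by (simp add: Q_def algebra_simps)
  moreover have "0 < int p" using p(1) by (simp add: prime_gt_0_nat)
  ultimately have "int p ^ Suc j dvd u ^ p - v ^ p \<longleftrightarrow> int p ^ j dvd (u - v) * R"
    by simp
  also have "\<dots> \<longleftrightarrow> int p ^ j dvd u - v"
    using R by (simp add: coprime_dvd_mult_left_iff)
  finally show ?thesis by (simp add: cong_iff_dvd_diff)
qed

subsection \<open>Factorizations of the group of units\<close>

lemma prime_cong_power_power_iff:
  fixes u v :: int
  assumes "prime p" "odd p" "coprime v (int p)" "[u = v] (mod int p)" "0 < j"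
  shows "[u ^ (p ^ n) = v ^ (p ^ n)] (mod int p ^ (j + n)) \<longleftrightarrow> [u = v] (mod int p ^ j)"
proof (induction n)
  case (Suc n)
  have "[(u ^ (p ^ n)) ^ p = (v ^ (p ^ n)) ^ p] (mod int p ^ Suc (j + n))
      \<longleftrightarrow> [u ^ (p ^ n) = v ^ (p ^ n)] (mod int p ^ (j + n))"
    using assms by (intro prime_cong_power_iff cong_pow) auto
  moreover have "(w ^ p ^ n) ^ p = w ^ p ^ Suc n" for w :: int
    by (simp only: power_mult[symmetric] power_Suc2)
  ultimately show ?case using Suc by simp
qed simp

lemma indicator_sum_eq_1:
  fixes f :: "'a \<Rightarrow> int"
  assumes "finite S" "s \<in> S" "f s = 1" "\<And>t. t \<in> S \<Longrightarrow> t \<noteq> s \<Longrightarrow> f t = 0"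
  shows "sum f S = 1"
proof -
  have "sum f S = f s + sum f (S - {s})" using assms by (intro sum.remove) auto
  also have "sum f (S - {s}) = 0" using assms by (intro sum.neutral) auto
  finally show ?thesis using assms by simp
qed

text \<open>A multiple of \<open>p\<close> between 1 and \<open>p\<close> is \<open>p\<close>, so
  none of the \<open>p\<close> summands can be 0.\<close>

lemma indicators_all_eq_1:
  fixes f :: "'a \<Rightarrow> int"
  assumes "finite S" "card S = p" "\<And>s. f s = 0 \<or> f s = 1" "int p dvd sum f S"
    and "s \<in> S" "f s = 1" "t \<in> S"
  shows "f t = 1"
proof -
  have bounds: "0 \<le> f s \<and> f s \<le> 1" for s using assms(3)[of s] by auto
  have "0 < sum f S"
    using assms bounds by (intro sum_pos2[of S s]) auto
  then have "int p \<le> sum f S"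
    using assms(4) by (intro zdvd_imp_le)
  then have "0 \<le> sum f S - int (card S)" using assms(2) by simp
  also have "\<dots> = - (\<Sum>s\<in>S. 1 - f s)" by (simp add: sum_subtractf)
  finally have "(\<Sum>s\<in>S. 1 - f s) \<le> 0" by simp
  moreover have "0 \<le> (\<Sum>s\<in>S. 1 - f s)" using bounds by (intro sum_nonneg) simp
  ultimately have "(\<Sum>s\<in>S. 1 - f s) = 0" by simp
  then have "1 - f t = 0"
    using bounds assms(1,7) by (subst (asm) sum_nonneg_eq_0_iff) auto
  then show ?thesis by simp
qed

text \<open>\<open>f\<close> marks residues modulo \<open>p ^ a\<close>, and \<open>tile\<close> is
  a factorization of the unit group by the marked units and the inverses of \<open>S\<close>. It is
  used for the modulus \<open>m\<close> and again one power of \<open>p\<close> lower.\<close>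

locale unit_tiling =
  fixes p a :: nat and S :: "int set" and f :: "int \<Rightarrow> int"
  assumes p: "prime p" and finite_S: "finite S"
    and coprime_S: "s \<in> S \<Longrightarrow> coprime s (int p)"
    and tile: "coprime g (int p) \<Longrightarrow> (\<Sum>s\<in>S. f (s * g)) = 1"
    and f_01: "f x = 0 \<or> f x = 1"
    and f_cong: "[x = y] (mod int p ^ a) \<Longrightarrow> f x = f y"
begin

lemma exists_one: obtains g where "coprime g (int p)" "f g = 1"
proof -
  have "\<exists>s\<in>S. f (s * 1) \<noteq> 0"
  proof (rule ccontr)
    assume "\<not> (\<exists>s\<in>S. f (s * 1) \<noteq> 0)"
    then have "(\<Sum>s\<in>S. f (s * 1)) = 0" by (intro sum.neutral) auto
    with tile[of 1] show False by simp
  qed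
  then obtain s where "s \<in> S" "f (s * 1) \<noteq> 0" by blast
  then show thesis using that[of s] f_01[of s] coprime_S by auto
qed

lemma frobenius:
  assumes "p dvd card S" "0 < n" "coprime g (int p)"
  shows "int p dvd (\<Sum>s\<in>S. f (s ^ (p ^ n) * g))"
  by (rule frobenius_sum[OF p finite_S, where q = "int p"]) (use assms coprime_S tile in auto)

lemma two_tile:
  assumes "S = {1, 2}" "coprime g (int p)"
  shows "f (2 ^ n * g) = (if even n then f g else 1 - f g)"
  using assms(2)
proof (induction n)
  case (Suc n)
  have "coprime (2 ^ n * g) (int p)"
    using Suc.prems coprime_S[of 2] assms(1) by simp
  from tile[OF this] Suc show ?case
    by (auto simp: assms(1) mult.assoc split: if_splits)
qed simp

end

text \<open>The trace of a tiling of the units modulo \<open>p\<^sup>a\<close> on the subgroup of \<open>p\<^bsup>a-2\<^esup>\<close>-th powers,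
  which is isomorphic to the group of units modulo \<open>p\<^sup>2\<close>.\<close>

locale reduced_tiling =
  fixes p :: nat and S :: "int set" and F :: "int \<Rightarrow> int"
  assumes p: "prime p" "odd p" and finite_S: "finite S"
    and coprime_S: "s \<in> S \<Longrightarrow> coprime s (int p)"
    and F_1: "F 1 = 1"
    and F_01: "F x = 0 \<or> F x = 1"
    and F_cong: "coprime v (int p) \<Longrightarrow> [u = v] (mod int p ^ 2) \<Longrightarrow> F u = F v"
    and F_inj: "F u = 1 \<Longrightarrow> F v = 1 \<Longrightarrow> coprime v (int p) \<Longrightarrow> [u = v] (mod int p)
      \<Longrightarrow> [u = v] (mod int p ^ 2)"
    and F_sum: "coprime u (int p) \<Longrightarrow> int p dvd (\<Sum>s\<in>S. F (s * u))"
    and F_sum_power: "coprime u (int p) \<Longrightarrow> int p dvd (\<Sum>s\<in>S. F (s ^ p * u))"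
begin

text \<open>With exactly \<open>p\<close> multipliers a positive sum divisible by \<open>p\<close>
  has all terms 1, so \<open>F\<close> stays 1 under doubling. Then \<open>F_inj\<close> lifts
  \<open>2 ^ (p - 1) = 1\<close> from modulus \<open>p\<close> to \<open>p ^ 2\<close>, against
  \<open>wieferich\<close>.\<close>

lemma card_neq:
  assumes S: "1 \<in> S" "2 \<in> S" and wieferich: "\<not> [2 ^ (p - 1) = 1] (mod int p ^ 2)"
  shows "card S \<noteq> p"
proof
  assume card: "card S = p"
  have all_one: "F (s * u) = 1" if u: "F u = 1" "coprime u (int p)" and s: "s \<in> S" for s u
    using u F_01 by (intro indicators_all_eq_1[OF finite_S card _ F_sum[OF u(2)] S(1) _ s]) auto
  have two: "coprime (2 ^ n :: int) (int p)" for n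
    using coprime_S[OF S(2)] by simp
  have "F (2 ^ n) = 1" for n
    by (induction n) (use F_1 all_one[OF _ two S(2)] in auto)
  moreover have "[2 ^ (p - 1) = 1] (mod int p)"
  proof -
    have "\<not> p dvd 2" using p primes_dvd_imp_eq[of p 2] by auto
    then have "[int (2 ^ (p - 1)) = int 1] (mod int p)"
      unfolding cong_int_iff by (rule fermat_theorem[OF p(1)])
    then show ?thesis by simp
  qed
  ultimately have "[2 ^ (p - 1) = 1] (mod int p ^ 2)"
    using F_1 by (intro F_inj) auto
  with wieferich show False by contradiction
qed

end

context unit_tiling
begin

text \<open>With \<open>n = a - 2\<close>, the power \<open>p ^ n\<close> carries congruence of
  units modulo \<open>p ^ 2\<close> to congruence modulo \<open>p ^ a\<close>, and agreement modulo
  \<open>p\<close> to agreement modulo \<open>p ^ (a - 1)\<close>, where \<open>inj\<close> applies.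
  The two divisibilities are the Frobenius statement for \<open>n\<close> and \<open>n + 1\<close>;
  \<open>a \<ge> 3\<close> makes \<open>n\<close> positive.\<close>

lemma reduced_tiling:
  assumes odd: "odd p" and a: "3 \<le> a" and card: "p dvd card S"
    and g: "coprime g (int p)" "f g = 1"
    and inj: "\<And>x y. f x = 1 \<Longrightarrow> f y = 1 \<Longrightarrow> [x = y] (mod int p ^ (a - 1)) \<Longrightarrow> [x = y] (mod int p ^ a)"
  shows "reduced_tiling p S (\<lambda>u. f (u ^ (p ^ (a - 2)) * g))"
proof
  define n where "n = a - 2"
  have n: "a = n + 2" "0 < n" using a by (simp_all add: n_def)
  show "f (u ^ p ^ (a - 2) * g) = f (v ^ p ^ (a - 2) * g)"
    if v: "coprime v (int p)" "[u = v] (mod int p ^ 2)" for u v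
  proof (intro f_cong cong_mult cong_refl)
    have "[u = v] (mod int p)" using v(2) by (rule cong_dvd_modulus) simp
    with v show "[u ^ p ^ (a - 2) = v ^ p ^ (a - 2)] (mod int p ^ a)"
      using prime_cong_power_power_iff[OF p odd, of v u 2 n] by (simp add: n add.commute)
  qed
  show "[u = v] (mod int p ^ 2)"
    if *: "f (u ^ p ^ (a - 2) * g) = 1" "f (v ^ p ^ (a - 2) * g) = 1" "coprime v (int p)" "[u = v] (mod int p)"
    for u v
  proof -
    have "[u ^ p ^ n = v ^ p ^ n] (mod int p ^ (1 + n))"
      using * prime_cong_power_power_iff[OF p odd, of v u 1 n] by simp
    then have "[u ^ p ^ n * g = v ^ p ^ n * g] (mod int p ^ (a - 1))"
      by (intro cong_mult) (simp_all add: n)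
    then have "[u ^ p ^ n * g = v ^ p ^ n * g] (mod int p ^ a)"
      using * by (intro inj) (simp_all add: n)
    then have "[u ^ p ^ n = v ^ p ^ n] (mod int p ^ (2 + n))"
      using g by (simp add: cong_mult_rcancel n add.commute)
    then show ?thesis
      using * prime_cong_power_power_iff[OF p odd, of v u 2 n] by simp
  qed
  show "int p dvd (\<Sum>s\<in>S. f ((s * u) ^ p ^ (a - 2) * g))" if "coprime u (int p)" for u
    using frobenius[OF card n(2), of "u ^ p ^ n * g"] that g
    by (simp add: n power_mult_distrib mult.assoc)
  show "int p dvd (\<Sum>s\<in>S. f ((s ^ p * u) ^ p ^ (a - 2) * g))" if "coprime u (int p)" for u
    using frobenius[OF card, of "Suc n" "u ^ p ^ n * g"] that g
    by (simp add: n power_mult_distrib power_mult mult.assoc)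
qed (use p odd finite_S coprime_S f_01 g in auto)

end

text \<open>The weights \<open>W\<close> have total 0 over \<open>B\<close>, so this condition excludes elements of \<open>p\<close>-adic valuation 1
  from \<open>B\<close>.\<close>

definition balanced :: "int \<Rightarrow> int \<Rightarrow> int \<Rightarrow> bool" where
  "balanced k1 k2 p \<longleftrightarrow>
    (let W = row_weight (multipliers k1 k2) [(1, -1), (p, p + 1), (p ^ 2, - p)]
     in W 1 = 0 \<and> 0 < W p \<and> W (p ^ 2) = 0)"

section \<open>Perfect splittings of prime power order as tilings of units\<close>

locale prime_power_splitting = perfect_splitting +
  fixes p a :: nat
  assumes p: "prime p" and m: "m = int p ^ a" and p_in_S: "int p \<in> S"
begin

text \<open>The indicator of the inverses of the elements of \<open>B\<close>: the factorization then reads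
  \<open>(\<Sum>s. ind e (s * g)) = 1\<close>, without inverses of the multipliers.\<close>

definition ind :: "nat \<Rightarrow> int \<Rightarrow> int" where
  "ind e x = (if \<exists>b\<in>B. [x * b = 1] (mod int p ^ e) then 1 else 0)"

lemma ind_01: "ind e x = 0 \<or> ind e x = 1"
  by (simp add: ind_def)

lemma ind_cong: "[x = y] (mod int p ^ e) \<Longrightarrow> ind e x = ind e y"
  unfolding ind_def by (metis cong_scalar_right cong_sym cong_trans)

lemma ind_mono:
  assumes "ind e x = 1" "e' \<le> e"
  shows "ind e' x = 1"
  using assms unfolding ind_def
  by (metis cong_dvd_modulus le_imp_power_dvd zero_neq_one)

text \<open>Multiplying the congruence by the elements \<open>b\<close>, \<open>b'\<close> inverse
  to \<open>x\<close>, \<open>y\<close> gives \<open>t * b = t' * b'\<close> modulo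
  \<open>p ^ (a - j)\<close>. Hence the multipliers \<open>p ^ j * t\<close> and
  \<open>p ^ j * t'\<close> send \<open>b\<close> and \<open>b'\<close> to the same residue modulo
  \<open>m\<close>.\<close>

lemma packing:
  assumes "ind e x = 1" "ind e y = 1" "j \<le> a" "a - j \<le> e"
    and "int p ^ j * t \<in> S" "int p ^ j * t' \<in> S" "[t * y = t' * x] (mod int p ^ (a - j))"
  shows "t = t' \<and> [x = y] (mod int p ^ e)"
proof -
  obtain b where b: "b \<in> B" "[x * b = 1] (mod int p ^ e)"
    using assms(1) by (auto simp: ind_def split: if_splits)
  obtain b' where b': "b' \<in> B" "[y * b' = 1] (mod int p ^ e)"
    using assms(2) by (auto simp: ind_def split: if_splits)
  let ?q = "int p ^ (a - j)"
  have dvd: "?q dvd int p ^ e" using assms(4) by (rule le_imp_power_dvd)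
  have "[t * b = t * b * (y * b')] (mod ?q)"
    using cong_mult[OF cong_refl cong_sym[OF cong_dvd_modulus[OF b'(2) dvd]], of "t * b"] by simp
  also have "t * b * (y * b') = (t * y) * (b * b')" by simp
  also have "[(t * y) * (b * b') = (t' * x) * (b * b')] (mod ?q)"
    using assms(7) by (rule cong_mult) simp
  also have "(t' * x) * (b * b') = t' * b' * (x * b)" by simp
  also have "[t' * b' * (x * b) = t' * b' * 1] (mod ?q)"
    using cong_dvd_modulus[OF b(2) dvd] by (intro cong_mult) auto
  finally have "[t * b = t' * b'] (mod ?q)" by simp
  then have "?q dvd t * b - t' * b'"
    by (simp add: cong_iff_dvd_diff)
  then have "int p ^ j * ?q dvd int p ^ j * (t * b - t' * b')"
    by (intro mult_dvd_mono) auto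
  then have "[int p ^ j * t * b = int p ^ j * t' * b'] (mod m)"
    using assms(3) by (simp add: cong_iff_dvd_diff m power_add[symmetric] algebra_simps)
  from mult_inj[OF assms(5) b(1) assms(6) b'(1) this] have eq: "t = t'" "b = b'"
    using prime_gt_0_nat[OF p] by auto
  have "[x = x * (y * b)] (mod int p ^ e)"
    using cong_mult[OF cong_refl cong_sym[OF b'(2)], of x] eq by simp
  also have "x * (y * b) = y * (x * b)" by simp
  also have "[y * (x * b) = y * 1] (mod int p ^ e)"
    using b(2) by (intro cong_mult) auto
  finally show ?thesis using eq by simp
qed

lemma ind_injective:
  assumes "ind e x = 1" "ind e y = 1" "j \<le> a" "a - j \<le> e" "int p ^ j \<in> S"
    and "[x = y] (mod int p ^ (a - j))"
  shows "[x = y] (mod int p ^ e)"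
  using packing[OF assms(1-4), of 1 1] assms(5,6) by (simp add: cong_sym)

lemma inverse_mod:
  assumes "coprime g (int p)"
  obtains y where "[g * y = 1] (mod m)" "coprime y (int p)"
proof -
  obtain y where y: "[g * y = 1] (mod m)"
    using assms cong_solve_coprime_int[of g m] by (auto simp: m)
  show thesis
  proof (cases "a = 0")
    case True
    then show thesis using that[of 1] by (simp add: m)
  next
    case False
    then have "int p dvd m" by (simp add: m)
    with y have "[g * y = 1] (mod int p)" by (rule cong_dvd_modulus)
    then have "coprime (g * y) (int p)" by (metis cong_imp_coprime cong_sym coprime_1_left)
    with y that show thesis by simp
  qed
qed

lemma unit_not_dvd:
  assumes "coprime y (int p)" "0 < a"
  shows "\<not> m dvd y * int p ^ j \<or> a \<le> j"
proof (rule ccontr)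
  assume "\<not> (\<not> m dvd y * int p ^ j \<or> a \<le> j)"
  then have *: "int p ^ a dvd y * int p ^ j" "j < a" by (auto simp: m)
  then have "int p ^ a dvd int p ^ j"
    using assms(1) by (simp add: coprime_dvd_mult_right_iff coprime_commute)
  then have "int p ^ a \<le> int p ^ j"
    using prime_gt_0_nat[OF p] by (intro zdvd_imp_le) auto
  then have "a \<le> j"
    using prime_gt_1_nat[OF p] by (intro power_le_imp_le_exp) auto
  with * show False by simp
qed

definition unit_multipliers :: "int set" where
  "unit_multipliers = {s \<in> S. \<not> int p dvd s}"

definition level_one_multipliers :: "int set" where
  "level_one_multipliers = {t. int p * t \<in> S \<and> \<not> int p dvd t}"

lemma coprime_p_iff: "coprime s (int p) \<longleftrightarrow> \<not> int p dvd s"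
  using p by (metis coprime_commute coprime_absorb_left not_prime_unit prime_imp_coprime prime_int_nat_transfer prime_nat_int_transfer)

text \<open>The unique representation \<open>s * b = y\<close> of the inverse \<open>y\<close> of
  \<open>g\<close> says that \<open>b\<close> is inverse to \<open>s * g\<close>; \<open>s\<close>
  is prime to \<open>p\<close> because \<open>y\<close> is.\<close>

lemma unit_tiling_0:
  assumes "0 < a"
  shows "unit_tiling p a unit_multipliers (ind a)"
proof
  fix g assume g: "coprime g (int p)"
  obtain y where y: "[g * y = 1] (mod m)" "coprime y (int p)"
    using inverse_mod[OF g] .
  have "\<not> m dvd y" using unit_not_dvd[OF y(2) assms, of 0] assms by simp
  then obtain s b where sb: "s \<in> S" "b \<in> B" "[s * b = y] (mod m)"
    by (rule mult_surj)
  have inv: "[s' * g * b' = 1] (mod m) \<longleftrightarrow> [s' * b' = y] (mod m)" for s' b'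
  proof -
    have "coprime g m" using g by (simp add: m)
    then have "[s' * b' = y] (mod m) \<longleftrightarrow> [g * (s' * b') = g * y] (mod m)"
      by (simp add: cong_mult_lcancel)
    also have "\<dots> \<longleftrightarrow> [g * (s' * b') = 1] (mod m)"
      using y(1) cong_trans cong_sym by blast
    finally show ?thesis by (simp add: mult_ac)
  qed
  have "int p dvd m" using assms by (simp add: m)
  then have "[s * b = y] (mod int p)" using sb(3) cong_dvd_modulus by blast
  then have "\<not> int p dvd s"
    using y(2) by (metis coprime_p_iff cong_dvd_iff dvd_mult2)
  then have s: "s \<in> unit_multipliers" using sb by (simp add: unit_multipliers_def)
  show "(\<Sum>s\<in>unit_multipliers. ind a (s * g)) = 1"
  proof (rule indicator_sum_eq_1)
    show "finite unit_multipliers" by (simp add: unit_multipliers_def)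
    show "s \<in> unit_multipliers" by (rule s)
    show "ind a (s * g) = 1"
      using inv sb by (auto simp: ind_def m)
    fix s' assume s': "s' \<in> unit_multipliers" "s' \<noteq> s"
    have "\<not> [s' * b' = y] (mod m)" if "b' \<in> B" for b'
    proof
      assume "[s' * b' = y] (mod m)"
      then have "[s' * b' = s * b] (mod m)" using cong_sym[OF sb(3)] by (rule cong_trans)
      then show False
        using mult_inj[OF _ that sb(1,2), of s'] s' by (simp add: unit_multipliers_def)
    qed
    then show "ind a (s' * g) = 0"
      using inv by (simp add: ind_def m)
  qed
qed (use p ind_01 ind_cong coprime_p_iff in \<open>auto simp: unit_multipliers_def\<close>)

text \<open>A residue \<open>p * y\<close> with \<open>y\<close> a unit is some
  \<open>s * b\<close>. As \<open>B\<close> has no element of valuation 1, the factor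
  \<open>p\<close> sits in \<open>s\<close>, and cancelling it leaves a representation of
  \<open>y\<close> modulo \<open>p ^ (a - 1)\<close>.\<close>

lemma unit_tiling_1:
  assumes "2 \<le> a" and weights: "balanced k1 k2 (int p)"
  shows "unit_tiling p (a - 1) level_one_multipliers (ind (a - 1))"
proof -
  define h where "h = [(1, -1), (int p, int p + 1), (int p ^ 2, - int p)]"
  let ?W = "row_weight (multipliers k1 k2) h"
  have W: "?W 1 = 0" "0 < ?W (int p)" "?W (int p ^ 2) = 0"
    using weights unfolding h_def balanced_def Let_def by blast+
  have p0: "0 < int p" using p prime_gt_0_nat by simp
  have gcd_cases: "gcd b (int p ^ 2) \<in> {1, int p, int p ^ 2}" for b
  proof -
    have "gcd b (int p ^ 2) dvd int p ^ 2" by simp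
    then obtain i where "i \<le> 2" "gcd b (int p ^ 2) = int p ^ i"
      using divides_primepow[of "int p" "gcd b (int p ^ 2)" 2] p by (auto simp: zero_le_power)
    moreover from \<open>i \<le> 2\<close> have "i = 0 \<or> i = 1 \<or> i = 2" by auto
    ultimately show ?thesis by auto
  qed
  have adm: "admissible h (int p ^ 2)"
    using p0 by (auto simp: admissible_def h_def)
  have "m = int p ^ 2 * int p ^ (a - 2)"
    using assms(1) by (simp only: m power_add[symmetric] le_add_diff_inverse)
  \<comment> \<open>The coefficients of \<open>h\<close> sum to 0 and satisfy
    \<open>- p ^ 2 + (p + 1) * p - p = 0\<close>, so both parts of the total vanish for every
    \<open>a \<ge> 2\<close>.\<close>
  from sum_row_weight[OF this _ adm] have "(\<Sum>b\<in>B. ?W (gcd b (int p ^ 2))) = 0"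
    using p0 by (simp add: total_def h_def power2_eq_square algebra_simps)
  moreover have nonneg: "0 \<le> ?W (gcd b (int p ^ 2))" for b
    using gcd_cases[of b] W by auto
  ultimately have zero: "?W (gcd b (int p ^ 2)) = 0" if "b \<in> B" for b
    using that by (subst (asm) sum_nonneg_eq_0_iff) auto
  have no_level_one: "gcd b (int p ^ 2) \<noteq> int p" if "b \<in> B" for b
    using zero[OF that] W by auto
  show ?thesis
  proof
    fix g assume g: "coprime g (int p)"
    obtain y where y: "[g * y = 1] (mod m)" "coprime y (int p)"
      using inverse_mod[OF g] .
    let ?q = "int p ^ (a - 1)"
    have mq: "m = int p * ?q" using assms(1) by (cases a) (simp_all add: m)
    have "\<not> m dvd y * int p" using unit_not_dvd[OF y(2), of 1] assms by auto
    then obtain s b where sb: "s \<in> S" "b \<in> B" "[s * b = y * int p] (mod m)"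
      by (rule mult_surj)
    have lift: "[t * b' = y] (mod ?q) \<longleftrightarrow> [int p * t * b' = y * int p] (mod m)" for t b'
      using p0 unfolding mq cong_iff_dvd_diff
      by (simp add: mult.assoc mult.commute[of y] right_diff_distrib[symmetric])
    have inv: "[t * g * b' = 1] (mod ?q) \<longleftrightarrow> [t * b' = y] (mod ?q)" for t b'
    proof -
      have "[g * y = 1] (mod ?q)" using y(1) by (rule cong_dvd_modulus) (simp add: mq)
      moreover have "coprime g ?q" using g by simp
      then have "[t * b' = y] (mod ?q) \<longleftrightarrow> [g * (t * b') = g * y] (mod ?q)"
        by (simp add: cong_mult_lcancel)
      ultimately have "[t * b' = y] (mod ?q) \<longleftrightarrow> [g * (t * b') = 1] (mod ?q)"
        using cong_trans cong_sym by blast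
      then show ?thesis by (simp add: mult_ac)
    qed
    have p2: "int p ^ 2 dvd m" using assms(1) by (simp add: m le_imp_power_dvd)
    have sb2: "[s * b = y * int p] (mod int p ^ 2)" using sb(3) p2 by (rule cong_dvd_modulus)
    have "int p dvd s"
    proof (rule ccontr)
      assume "\<not> int p dvd s"
      then have s: "coprime s (int p)" by (simp add: coprime_p_iff)
      have "gcd (s * b) (int p ^ 2) = gcd (y * int p) (int p ^ 2)"
        using sb2 by (simp add: cong_gcd_eq)
      moreover have "gcd (s * b) (int p ^ 2) = gcd b (int p ^ 2)"
        using s by (intro gcd_mult_left_left_cancel) (simp add: coprime_commute)
      moreover have "gcd (y * int p) (int p ^ 2) = gcd (int p) (int p ^ 2)"
        using y(2) by (intro gcd_mult_left_left_cancel) (simp add: coprime_commute)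
      moreover have "gcd (int p) (int p ^ 2) = int p"
        by (simp add: gcd_proj1_if_dvd)
      ultimately show False using no_level_one[OF sb(2)] by simp
    qed
    then obtain t where t: "s = int p * t" by blast
    then have tb: "[t * b = y] (mod ?q)" using sb(3) lift by simp
    have "int p dvd ?q" using assms(1) by simp
    then have "[t * b = y] (mod int p)" using tb cong_dvd_modulus by blast
    then have "\<not> int p dvd t"
      using y(2) by (metis coprime_p_iff cong_dvd_iff dvd_mult2)
    then have t_mem: "t \<in> level_one_multipliers"
      using sb(1) t by (simp add: level_one_multipliers_def)
    show "(\<Sum>t\<in>level_one_multipliers. ind (a - 1) (t * g)) = 1"
    proof (rule indicator_sum_eq_1)
      have "(*) (int p) ` level_one_multipliers \<subseteq> S" by (auto simp: level_one_multipliers_def)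
      then show "finite level_one_multipliers"
        by (rule inj_on_finite[rotated]) (use p0 in \<open>auto simp: inj_on_def\<close>)
      show "t \<in> level_one_multipliers" by (rule t_mem)
      show "ind (a - 1) (t * g) = 1"
        using inv tb sb(2) by (auto simp: ind_def)
      fix t' assume t': "t' \<in> level_one_multipliers" "t' \<noteq> t"
      have "\<not> [t' * b' = y] (mod ?q)" if "b' \<in> B" for b'
      proof
        assume "[t' * b' = y] (mod ?q)"
        then have "[int p * t' * b' = s * b] (mod m)"
          unfolding lift using cong_sym[OF sb(3)] by (rule cong_trans)
        then show False
          using mult_inj[OF _ that sb(1,2), of "int p * t'"] t' t p0
          by (simp add: level_one_multipliers_def)
      qed
      then show "ind (a - 1) (t' * g) = 0"
        using inv by (simp add: ind_def)
    qed
  next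
    have "(*) (int p) ` level_one_multipliers \<subseteq> S" by (auto simp: level_one_multipliers_def)
    then show "finite level_one_multipliers"
      by (rule inj_on_finite[rotated]) (use p0 in \<open>auto simp: inj_on_def\<close>)
  qed (use p ind_01 ind_cong coprime_p_iff in \<open>auto simp: level_one_multipliers_def\<close>)
qed

end

section \<open>Traces modulo 9 and modulo 25\<close>

lemma coprime_5: "\<not> 5 dvd u \<Longrightarrow> coprime u (5 :: int)"
  using prime_imp_coprime[of 5 u] by (simp add: coprime_commute)

context reduced_tiling
begin

lemma no_isolated_one:
  assumes "1 \<in> S" "\<And>s. s \<in> S \<Longrightarrow> s \<noteq> 1 \<Longrightarrow> F s \<noteq> 1"
  shows False
proof -
  have "(\<Sum>s\<in>S. F (s * 1)) = 1"
    using assms F_1 F_01 finite_S by (intro indicator_sum_eq_1[of _ 1]) auto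
  then have "int p dvd 1" using F_sum[of 1] by simp
  then show False using p by simp
qed

text \<open>Multipliers that are 2 modulo 3 are excluded by \<open>neg\<close>; among those that are
  1 modulo 3, \<open>F_inj\<close> keeps only numbers that are 1 modulo 9. So 1 is isolated.\<close>

lemma ternary_contradiction:
  assumes "p = 3" "1 \<in> S" "\<And>s. s \<in> S \<Longrightarrow> s \<noteq> 1 \<Longrightarrow> s mod 9 \<noteq> 1"
    and neg: "\<And>u. F u = 1 \<Longrightarrow> u mod 3 = 2 \<Longrightarrow> False"
  shows False
proof (rule no_isolated_one[OF assms(2)], rule notI)
  fix s assume s: "s \<in> S" "s \<noteq> 1" "F s = 1"
  have "\<not> 3 dvd s" using coprime_S[OF s(1)] assms(1) by auto
  then have "s mod 3 = 1 \<or> s mod 3 = 2" by presburger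
  with neg[of s] s have "s mod 3 = 1" by blast
  then have "[s = 1] (mod int p ^ 2)"
    using s F_1 assms(1) by (intro F_inj) (auto simp: cong_def)
  with assms s show False by (simp add: cong_def)
qed

lemma F_eq_0:
  assumes "F v = 1" "coprime v (int p)" "[s = v] (mod int p)" "\<not> [s = v] (mod int p ^ 2)"
  shows "F s = 0"
  using assms F_inj[of s v] F_01[of s] by blast

text \<open>Fifth powers modulo 25 depend only on the residue modulo 5. The sums thus reduce to
  counting multipliers per class, with 1, 32, 243 and 1024 as the fourth roots of unity modulo
  25.\<close>

lemma F_power_5:
  assumes "p = 5" "s \<in> S" "coprime u 5"
  shows "F (s ^ 5 * u) = F ((s mod 5) ^ 5 * u)"
proof (rule F_cong)
  have s: "coprime s 5" using coprime_S[OF assms(2)] assms(1) by simp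
  then have sm: "coprime (s mod 5) 5" by simp
  then show "coprime ((s mod 5) ^ 5 * u) (int p)" using assms by simp
  have "[s ^ 5 = (s mod 5) ^ 5] (mod int p ^ Suc 1)"
    using prime_cong_power_iff[of 5 "s mod 5" s 1] sm assms(1) by (simp add: cong_def)
  then show "[s ^ 5 * u = (s mod 5) ^ 5 * u] (mod int p ^ 2)"
    by (intro cong_mult) (simp_all add: numeral_2_eq_2)
qed

lemma sum_power_5:
  assumes "p = 5" "coprime u 5"
  shows "5 dvd (\<Sum>s\<in>S. F ((s mod 5) ^ 5 * u))"
proof -
  have "(\<Sum>s\<in>S. F ((s mod 5) ^ 5 * u)) = (\<Sum>s\<in>S. F (s ^ 5 * u))"
    using assms by (intro sum.cong) (simp_all add: F_power_5)
  then show ?thesis using F_sum_power[of u] assms by simp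
qed

lemma F_1024: "p = 5 \<Longrightarrow> F 1024 = F (- 1)"
  by (intro F_cong) (auto simp: cong_def)

text \<open>By class counts the sum of fifth powers is \<open>3 + 2 * F (- 1)\<close>,
  \<open>3 + 3 * F (- 1)\<close> or \<open>2 + 3 * F (- 1)\<close>, so it can only be divisible by 5
  if \<open>F (- 1) = 1\<close>. Then \<open>F_inj\<close> leaves the multipliers congruent to 1 or
  -1 modulo 25, and each \<open>S\<close> has only one or two of these.\<close>

lemma quinary_contradiction_double:
  assumes "p = 5" and excl: "\<And>u. F u = 1 \<Longrightarrow> u mod 5 = 2 \<or> u mod 5 = 3 \<Longrightarrow> False"
    and S: "S \<in> {{1, 2, 3, 4, 6, 7, 8, 9, 11, 12}, {-1, 1, 2, 3, 4, 6, 7, 8, 9, 11},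
      {-2, -1, 1, 2, 3, 4, 6, 7, 8, 9}}"
  shows False
proof -
  have zero: "F u = 0" if "u mod 5 = 2 \<or> u mod 5 = 3" for u
    using excl[of u] that F_01[of u] by blast
  have z: "F 32 = 0" "F 243 = 0" by (intro zero; simp)+
  have "5 dvd (\<Sum>s\<in>S. F ((s mod 5) ^ 5 * 1))" using assms(1) by (intro sum_power_5) auto
  then have F_m1: "F (-1) = 1"
    using S F_1 F_01[of "-1"] by (auto simp: z F_1024[OF assms(1)])
  have "F s = (if s mod 25 = 1 \<or> s mod 25 = 24 then 1 else 0)" if "s \<in> S" for s
  proof -
    have "\<not> 5 dvd s" using coprime_S[OF that] assms(1) by auto
    then have "s mod 5 = 1 \<or> s mod 5 = 4 \<or> s mod 5 = 2 \<or> s mod 5 = 3" by presburger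
    then consider "s mod 5 = 1" | "s mod 5 = 4" | "s mod 5 = 2 \<or> s mod 5 = 3" by blast
    then show ?thesis
    proof cases
      case 1
      then have "s mod 25 \<noteq> 24" by presburger
      moreover have "F s = 1" if "s mod 25 = 1"
        using F_cong[of 1 s] F_1 assms(1) that by (simp add: cong_def)
      moreover have "F s = 0" if "s mod 25 \<noteq> 1"
        using F_eq_0[of 1 s] F_1 assms(1) that 1 by (simp add: cong_def)
      ultimately show ?thesis by auto
    next
      case 2
      then have "s mod 25 \<noteq> 1" by presburger
      moreover have "F s = 1" if "s mod 25 = 24"
        using F_cong[of "-1" s] F_m1 assms(1) that by (simp add: cong_def)
      moreover have "F s = 0" if "s mod 25 \<noteq> 24"
        using F_eq_0[of "-1" s] F_m1 assms(1) that 2 by (simp add: cong_def)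
      ultimately show ?thesis by auto
    next
      case 3
      then have "s mod 25 \<noteq> 1" "s mod 25 \<noteq> 24" by presburger+
      with 3 show ?thesis using zero by simp
    qed
  qed
  then have "(\<Sum>s\<in>S. F (s * 1)) = (\<Sum>s\<in>S. if s mod 25 = 1 \<or> s mod 25 = 24 then 1 else 0)"
    by simp
  then have "5 dvd (\<Sum>s\<in>S. if s mod 25 = 1 \<or> s mod 25 = 24 then 1 else (0::int))"
    using F_sum[of 1] assms(1) by simp
  then show False using S by auto
qed

text \<open>The class counts are 3, 3, 2, 2. As opposite classes exclude each other, a total
  divisible by 5 must be 3 + 2, which passes the value 1 from \<open>u\<close> to
  \<open>243 * u\<close>. Two such steps reach the class opposite to 1.\<close>

lemma quinary_contradiction_5_7:
  assumes "p = 5" and excl: "\<And>u v. F u = 1 \<Longrightarrow> F v = 1 \<Longrightarrow> \<not> 5 dvd u \<Longrightarrow> (u + v) mod 5 = 0 \<Longrightarrow> False"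
    and S: "S = {-4, -3, -2, -1, 1, 2, 3, 4, 6, 7}"
  shows False
proof -
  have step: "F (243 * u) = 1" if u: "F u = 1" "\<not> 5 dvd u" for u
  proof -
    have "coprime u 5" using u(2) by (rule coprime_5)
    then have "5 dvd (\<Sum>s\<in>S. F ((s mod 5) ^ 5 * u))" by (intro sum_power_5 assms)
    then have "5 dvd 3 * F u + 3 * F (32 * u) + 2 * F (243 * u) + 2 * F (1024 * u)"
      by (simp add: S algebra_simps)
    moreover have "F (1024 * u) \<noteq> 1"
      using excl[of u "1024 * u"] u by (auto simp: mod_eq_0_iff_dvd)
    moreover have "\<not> (F (32 * u) = 1 \<and> F (243 * u) = 1)"
      using excl[of "32 * u" "243 * u"] u by (auto simp: mod_eq_0_iff_dvd prime_dvd_mult_iff)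
    ultimately show ?thesis
      using u F_01[of "32 * u"] F_01[of "243 * u"] F_01[of "1024 * u"] by auto
  qed
  have "F (243 * 1) = 1" using F_1 by (intro step) auto
  then have "F (243 * 243) = 1" by (intro step) auto
  then show False using excl[of 1 "243 * 243"] F_1 by simp
qed

text \<open>The class counts 3, 2, 2, 3 force exactly one of \<open>F 32\<close>,
  \<open>F 243\<close> to be 1. Any other multiplier with value 1 would then be congruent to 1, 7 or
  18 modulo 25, and \<open>S\<close> contains none.\<close>

lemma quinary_contradiction_6_6:
  assumes "p = 5" and excl: "\<And>u v. F u = 1 \<Longrightarrow> F v = 1 \<Longrightarrow> \<not> 5 dvd u \<Longrightarrow> (u + v) mod 5 = 0 \<Longrightarrow> False"
    and S: "S = {-6, -4, -3, -2, -1, 1, 2, 3, 4, 6}"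
  shows False
proof -
  have "5 dvd (\<Sum>s\<in>S. F ((s mod 5) ^ 5 * 1))" using assms(1) by (intro sum_power_5) auto
  then have "5 dvd 3 * F 1 + 2 * F 32 + 2 * F 243 + 3 * F 1024"
    by (simp add: S algebra_simps)
  moreover have "F 1024 \<noteq> 1" using excl[of 1 1024] F_1 by auto
  moreover have not_both: "\<not> (F 32 = 1 \<and> F 243 = 1)" using excl[of 32 243] by auto
  ultimately have one: "F 32 = 1 \<or> F 243 = 1"
    using F_1 F_01[of 32] F_01[of 243] F_01[of 1024] by auto
  show False
  proof (rule no_isolated_one)
    show "1 \<in> S" by (simp add: S)
    fix s assume s: "s \<in> S" "s \<noteq> 1"
    show "F s \<noteq> 1"
    proof
      assume Fs: "F s = 1"
      have inj: "[s = v] (mod 25)" if "F v = 1" "\<not> 5 dvd v" "[s = v] (mod 5)" for v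
        using F_inj[OF Fs that(1)] that(2,3) assms(1) by (simp add: coprime_5)
      have n: "(s + 1) mod 5 \<noteq> 0" using excl[of 1 s] F_1 Fs by (auto simp: add.commute)
      have p1: "[s = 1] (mod 5) \<Longrightarrow> [s = 1] (mod 25)" using inj[of 1] F_1 by simp
      from one show False
      proof
        assume a: "F 32 = 1"
        have "(32 + s) mod 5 \<noteq> 0" using excl[of 32 s] a Fs by auto
        moreover have "[s = 32] (mod 5) \<Longrightarrow> [s = 32] (mod 25)" using inj[of 32] a by simp
        ultimately show False using n p1 s by (auto simp: S cong_def)
      next
        assume a: "F 243 = 1"
        have "(243 + s) mod 5 \<noteq> 0" using excl[of 243 s] a Fs by auto
        moreover have "[s = 243] (mod 5) \<Longrightarrow> [s = 243] (mod 25)" using inj[of 243] a by simp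
        ultimately show False using n p1 s by (auto simp: S cong_def)
      qed
    qed
  qed
qed

end

subsection \<open>Bounds for the exponent\<close>

text \<open>Starting from \<open>9 = 1 + 8\<close>, each squaring raises the exact power of 2 in
  \<open>9 ^ (2 ^ j) - 1\<close> by one; this replaces the lifting for odd primes.\<close>

lemma nine_power_cong: "[9 ^ (2 ^ j) = 1 + 2 ^ (j + 3)] (mod (2 :: int) ^ (j + 4))"
proof (induction j)
  case (Suc j)
  obtain k where k: "9 ^ (2 ^ j) = 1 + 2 ^ (j + 3) + 2 ^ (j + 4) * (k :: int)"
    using Suc by (metis cong_iff_lin cong_sym)
  have "(9 :: int) ^ (2 ^ Suc j) = (9 ^ (2 ^ j)) ^ 2" for j :: nat
    by (simp only: power_mult[symmetric] power_Suc2)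
  then have "9 ^ (2 ^ Suc j) = (1 + 2 ^ (j + 3) + 2 ^ (j + 4) * k) ^ 2"
    by (simp only: k)
  also have "\<dots> = 1 + 2 ^ (j + 4) + 2 ^ (j + 5) * (k + 2 ^ (j + 1) + 2 ^ (j + 3) * k + 2 ^ (j + 3) * k ^ 2)"
    by (simp add: power2_eq_square power_add algebra_simps)
  finally have "9 ^ (2 ^ Suc j) - (1 + 2 ^ (Suc j + 3))
      = 2 ^ (j + 5) * (k + 2 ^ (j + 1) + 2 ^ (j + 3) * k + 2 ^ (j + 3) * k ^ 2)"
    by (simp add: power_add)
  then show ?case unfolding cong_iff_dvd_diff by (simp add: power_add)
qed (simp add: cong_def)

text \<open>The squares of the multipliers 3 and 5 differ by 16. Each further squaring multiplies
  the difference by the sum of the two powers, which is twice an odd number.\<close>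

lemma nine_25_power_cong: "[25 ^ (2 ^ j) = 9 ^ (2 ^ j) + 2 ^ (j + 4)] (mod (2 :: int) ^ (j + 5))"
proof (induction j)
  case (Suc j)
  obtain k where k: "25 ^ (2 ^ j) = 9 ^ (2 ^ j) + 2 ^ (j + 4) + 2 ^ (j + 5) * (k :: int)"
    using Suc by (metis cong_iff_lin cong_sym)
  have sq: "x ^ (2 ^ Suc j) = (x ^ (2 ^ j)) ^ 2" for j :: nat and x :: int
    by (simp only: power_mult[symmetric] power_Suc2)
  have "odd (9 ^ (2 ^ j) :: int)" by simp
  then obtain l where l: "9 ^ (2 ^ j) = 2 * l + (1 :: int)" by (rule oddE)
  have "25 ^ (2 ^ Suc j) = (9 ^ (2 ^ j) + 2 ^ (j + 4) + 2 ^ (j + 5) * k) ^ 2"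
    by (simp only: k sq)
  also have "\<dots> = (9 ^ (2 ^ j)) ^ 2 + 9 ^ (2 ^ j) * 2 ^ (j + 5) * (1 + 2 * k) + (2 ^ (j + 4) * (1 + 2 * k)) ^ 2"
    by (simp add: power2_eq_square power_add algebra_simps)
  also have "\<dots> = 9 ^ (2 ^ Suc j) + 2 ^ (j + 5) + 2 ^ (j + 6) * (l + l * 2 * k + k + 2 ^ (j + 2) * (1 + 2 * k) ^ 2)"
    unfolding sq by (simp add: l power2_eq_square power_add algebra_simps)
  finally show ?case
    unfolding cong_iff_dvd_diff by (simp add: power_add)
qed (simp add: cong_def)

context prime_power_splitting
begin

lemma level_one_multipliers_eq:
  "level_one_multipliers = (\<lambda>s. s div int p) ` set (filter (\<lambda>s. int p dvd s \<and> \<not> int p ^ 2 dvd s) (multipliers k1 k2))"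
proof -
  have "0 < int p" using p prime_gt_0_nat by simp
  then show ?thesis
    by (force simp: level_one_multipliers_def set_multipliers power2_eq_square image_iff)
qed

lemma ind_inj_1:
  assumes "2 \<le> a" "ind a x = 1" "ind a y = 1" "[x = y] (mod int p ^ (a - 1))"
  shows "[x = y] (mod int p ^ a)"
  using ind_injective[OF assms(2,3), of 1] assms p_in_S by simp

lemma exists_reduced_tiling:
  assumes "odd p" "3 \<le> a" "p dvd card unit_multipliers"
  obtains g where "coprime g (int p)" "ind a g = 1"
    "reduced_tiling p unit_multipliers (\<lambda>u. ind a (u ^ (p ^ (a - 2)) * g))"
proof -
  interpret unit_tiling p a unit_multipliers "ind a"
    using assms by (intro unit_tiling_0) simp
  obtain g where "coprime g (int p)" "ind a g = 1" by (rule exists_one)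
  with that assms show thesis
    using reduced_tiling[of g] ind_inj_1 by simp
qed

lemma card_units_eq_p_small:
  assumes "odd p" "card unit_multipliers = p" "1 \<in> unit_multipliers" "2 \<in> unit_multipliers"
    and "\<not> [2 ^ (p - 1) = 1] (mod int p ^ 2)"
  shows "a < 3"
proof (rule ccontr)
  assume "\<not> a < 3"
  then obtain g where "reduced_tiling p unit_multipliers (\<lambda>u. ind a (u ^ (p ^ (a - 2)) * g))"
    using exists_reduced_tiling assms by auto
  then show False using reduced_tiling.card_neq assms by blast
qed

text \<open>At \<open>a = 2\<close> the Frobenius step marks \<open>w ^ p * g\<close> together with
  \<open>g\<close>, for every multiplier \<open>w\<close>. Then \<open>s * g\<close> and
  \<open>t * (w ^ p * g)\<close> coincide, against \<open>packing\<close>.\<close>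

lemma card_units_eq_p_square:
  assumes "card unit_multipliers = p" "1 \<in> unit_multipliers"
    and "s \<in> unit_multipliers" "t \<in> unit_multipliers" "w \<in> unit_multipliers"
    and "[s = t * w ^ p] (mod int p ^ 2)" "s \<noteq> t"
  shows "a \<noteq> 2"
proof
  assume a: "a = 2"
  interpret unit_tiling p a unit_multipliers "ind a"
    using a by (intro unit_tiling_0) simp
  obtain g where g: "coprime g (int p)" "ind a g = 1" by (rule exists_one)
  have "ind a (w ^ p * g) = 1"
  proof (rule indicators_all_eq_1[OF finite_S assms(1), where f = "\<lambda>s. ind a (s ^ p * g)" and s = 1])
    show "int p dvd (\<Sum>s\<in>unit_multipliers. ind a (s ^ p * g))"
      using frobenius[of 1 g] g assms(1) by simp
  qed (use assms g f_01 in auto)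
  moreover have "[t * (w ^ p * g) = s * g] (mod int p ^ (a - 0))"
    using cong_mult[OF cong_sym[OF assms(6)], of g g] a by (simp add: mult.assoc)
  ultimately have "t = s"
    using packing[OF g(2), of "w ^ p * g" 0 t s] assms(3,4) by (simp add: unit_multipliers_def)
  with assms(7) show False by simp
qed

text \<open>The \<open>p ^ (a - 2)\<close>-th powers are opposite modulo \<open>p ^ (a - 1)\<close>,
  so the multipliers \<open>p\<close> and \<open>- p\<close> would send elements of \<open>B\<close>
  to the same residue.\<close>

lemma no_negative:
  assumes "odd p" "3 \<le> a" "- int p \<in> S"
    and "ind a (u ^ (p ^ (a - 2)) * g) = 1" "ind a (v ^ (p ^ (a - 2)) * g) = 1"
    and "\<not> int p dvd u" "[v = - u] (mod int p)"
  shows False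
proof -
  define n where "n = a - 2"
  have n: "a = n + 2" using assms by (simp add: n_def)
  have "[v ^ (p ^ n) = (- u) ^ (p ^ n)] (mod int p ^ (1 + n))"
    using prime_cong_power_power_iff[OF p assms(1), of "- u" v 1 n] assms coprime_p_iff by simp
  also have "(- u) ^ (p ^ n) = - (u ^ (p ^ n))" using assms(1) by simp
  finally have "[v ^ (p ^ n) * g = - (u ^ (p ^ n)) * g] (mod int p ^ (1 + n))"
    by (intro cong_mult) auto
  then have "[1 * (v ^ (p ^ n) * g) = - 1 * (u ^ (p ^ n) * g)] (mod int p ^ (a - 1))"
    by (simp add: n)
  with packing[of a "u ^ (p ^ n) * g" "v ^ (p ^ n) * g" 1 1 "- 1"] assms p_in_S
  show False by (simp add: n)
qed

text \<open>The tile \<open>{1, 2}\<close> makes the indicator flip under doubling, and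
  \<open>k * p ^ (a - 2)\<close> is odd.\<close>

lemma no_odd_double:
  assumes "odd p" "3 \<le> a" and tiling: "unit_tiling p (a - 1) {1, 2} (ind (a - 1))"
    and "coprime g (int p)"
    and "ind a g = 1" "ind a (v ^ (p ^ (a - 2)) * g) = 1"
    and "[v = 2 ^ k] (mod int p)" "odd k"
  shows False
proof -
  interpret unit_tiling p "a - 1" "{1, 2}" "ind (a - 1)" by (rule tiling)
  define n where "n = a - 2"
  have n: "a = n + 2" using assms by (simp add: n_def)
  have "[v ^ (p ^ n) = (2 ^ k) ^ (p ^ n)] (mod int p ^ (1 + n))"
    using prime_cong_power_power_iff[OF p assms(1), of "2 ^ k" v 1 n] assms coprime_S[of 2] by simp
  then have "[v ^ (p ^ n) * g = 2 ^ (k * p ^ n) * g] (mod int p ^ (a - 1))"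
    by (intro cong_mult) (simp_all add: n power_mult)
  then have "ind (a - 1) (v ^ (p ^ n) * g) = ind (a - 1) (2 ^ (k * p ^ n) * g)"
    by (rule ind_cong)
  also have "\<dots> = 1 - ind (a - 1) g"
    using assms by (subst two_tile) auto
  finally show False
    using ind_mono[OF assms(5), of "a - 1"] ind_mono[OF assms(6), of "a - 1"] by (simp add: n)
qed

lemma ternary_exponent:
  assumes "p = 3" "3 dvd card unit_multipliers" "1 \<in> unit_multipliers"
    and "\<And>s. s \<in> unit_multipliers \<Longrightarrow> s \<noteq> 1 \<Longrightarrow> s mod 9 \<noteq> 1"
    and "- 3 \<in> S \<or> (2 \<le> a \<longrightarrow> unit_tiling p (a - 1) {1, 2} (ind (a - 1)))"
  shows "a < 3"
proof (rule ccontr)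
  assume "\<not> a < 3"
  then have a: "3 \<le> a" by simp
  obtain g where g: "coprime g (int p)" "ind a g = 1"
    and red: "reduced_tiling p unit_multipliers (\<lambda>u. ind a (u ^ (p ^ (a - 2)) * g))"
    using exists_reduced_tiling a assms by auto
  show False
  proof (rule reduced_tiling.ternary_contradiction[OF red assms(1,3,4)])
    \<comment> \<open>Modulo 3 the residue 2 is both -1 and an odd power of 2, so either alternative
      excludes it.\<close>
    fix u assume u: "ind a (u ^ p ^ (a - 2) * g) = 1" "u mod 3 = 2"
    from assms(5) show False
    proof
      assume "- 3 \<in> S"
      then show False
        using no_negative[of 1 g u] a assms(1) g u by (simp add: cong_def)
    next
      assume "2 \<le> a \<longrightarrow> unit_tiling p (a - 1) {1, 2} (ind (a - 1))"
      then show False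
        using no_odd_double[of g u 1] a assms(1) g u by (simp add: cong_def)
    qed
  qed
qed

lemma quinary_exponent:
  assumes "p = 5"
    and "(unit_multipliers \<in> {{1, 2, 3, 4, 6, 7, 8, 9, 11, 12}, {-1, 1, 2, 3, 4, 6, 7, 8, 9, 11},
           {-2, -1, 1, 2, 3, 4, 6, 7, 8, 9}}
         \<and> (2 \<le> a \<longrightarrow> unit_tiling p (a - 1) {1, 2} (ind (a - 1))))
       \<or> (unit_multipliers \<in> {{-4, -3, -2, -1, 1, 2, 3, 4, 6, 7}, {-6, -4, -3, -2, -1, 1, 2, 3, 4, 6}}
         \<and> - 5 \<in> S)"
  shows "a < 3"
proof (rule ccontr)
  assume "\<not> a < 3"
  then have a: "3 \<le> a" by simp
  have "card unit_multipliers = 10" using assms(2) by (elim disjE conjE) (auto simp: eval_nat_numeral)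
  then have "p dvd card unit_multipliers" using assms(1) by simp
  then obtain g where g: "coprime g (int p)" "ind a g = 1"
    and red: "reduced_tiling p unit_multipliers (\<lambda>u. ind a (u ^ (p ^ (a - 2)) * g))"
    using exists_reduced_tiling a assms by auto
  from assms(2) show False
  proof (elim disjE conjE)
    assume U: "unit_multipliers \<in> {{1, 2, 3, 4, 6, 7, 8, 9, 11, 12}, {-1, 1, 2, 3, 4, 6, 7, 8, 9, 11},
           {-2, -1, 1, 2, 3, 4, 6, 7, 8, 9}}"
      and tiling: "2 \<le> a \<longrightarrow> unit_tiling p (a - 1) {1, 2} (ind (a - 1))"
    show False
    proof (rule reduced_tiling.quinary_contradiction_double[OF red assms(1) _ U])
      \<comment> \<open>The odd powers of 2 modulo 5 are 2 and 3, the latter being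
        \<open>2 ^ 3\<close>.\<close>
      fix u assume u: "ind a (u ^ p ^ (a - 2) * g) = 1" "u mod 5 = 2 \<or> u mod 5 = 3"
      then show False
        using no_odd_double[of g u 1] no_odd_double[of g u 3] tiling a assms(1) g
        by (auto simp: cong_def)
    qed
  next
    assume U: "unit_multipliers \<in> {{-4, -3, -2, -1, 1, 2, 3, 4, 6, 7}, {-6, -4, -3, -2, -1, 1, 2, 3, 4, 6}}"
      and m5: "- 5 \<in> S"
    have neg: False if "ind a (u ^ p ^ (a - 2) * g) = 1" "ind a (v ^ p ^ (a - 2) * g) = 1"
      "\<not> 5 dvd u" "(u + v) mod 5 = 0" for u v
      using no_negative[of u g v] a assms(1) that m5
      by (auto simp: cong_iff_dvd_diff add.commute mod_eq_0_iff_dvd)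
    from U have "unit_multipliers = {-4, -3, -2, -1, 1, 2, 3, 4, 6, 7}
      \<or> unit_multipliers = {-6, -4, -3, -2, -1, 1, 2, 3, 4, 6}" by simp
    then show False
    proof
      assume U: "unit_multipliers = {-4, -3, -2, -1, 1, 2, 3, 4, 6, 7}"
      show False
        by (rule reduced_tiling.quinary_contradiction_5_7[OF red assms(1) _ U]) (rule neg)
    next
      assume U: "unit_multipliers = {-6, -4, -3, -2, -1, 1, 2, 3, 4, 6}"
      show False
        by (rule reduced_tiling.quinary_contradiction_6_6[OF red assms(1) _ U]) (rule neg)
    qed
  qed
qed

text \<open>The argument for \<open>p\<close> multipliers one level lower: the multiplier 9 now
  provides the injectivity that 3 provides modulo \<open>p ^ a\<close>, and \<open>2 ^ 2\<close> is
  not 1 modulo 9.\<close>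

lemma nonary_exponent:
  assumes "p = 3" "card level_one_multipliers = 3" "1 \<in> level_one_multipliers" "2 \<in> level_one_multipliers"
    and "9 \<in> S" "2 \<le> a \<longrightarrow> unit_tiling p (a - 1) level_one_multipliers (ind (a - 1))"
  shows "a < 4"
proof (rule ccontr)
  assume "\<not> a < 4"
  then have a: "4 \<le> a" by simp
  interpret unit_tiling p "a - 1" level_one_multipliers "ind (a - 1)"
    using assms(6) a by simp
  obtain g where g: "coprime g (int p)" "ind (a - 1) g = 1" by (rule exists_one)
  have "reduced_tiling p level_one_multipliers (\<lambda>u. ind (a - 1) (u ^ (p ^ (a - 1 - 2)) * g))"
  proof (rule reduced_tiling[OF _ _ _ g])
    fix x y assume xy: "ind (a - 1) x = 1" "ind (a - 1) y = 1" "[x = y] (mod int p ^ (a - 1 - 1))"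
    have "a - 1 - 1 = a - 2" by simp
    with xy(3) have "[x = y] (mod int p ^ (a - 2))" by (simp only:)
    then show "[x = y] (mod int p ^ (a - 1))"
      using a assms(1,5) ind_injective[OF xy(1,2), of 2] by simp
  qed (use a assms in auto)
  then show False
    using reduced_tiling.card_neq[of p level_one_multipliers] assms(1-4) by (auto simp: cong_def)
qed

text \<open>The tile \<open>{1, 3}\<close> makes the indicator invariant under 9, so
  \<open>g\<close> and \<open>9 ^ (2 ^ j) * g\<close> are both marked. They agree modulo
  \<open>2 ^ (a - 2)\<close> but not modulo \<open>2 ^ (a - 1)\<close>, which the multiplier 4
  forbids.\<close>

lemma binary_exponent_level_one:
  assumes "p = 2" "4 \<in> S" "2 \<le> a \<longrightarrow> unit_tiling p (a - 1) {1, 3} (ind (a - 1))"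
  shows "a < 6"
proof (rule ccontr)
  assume "\<not> a < 6"
  define j where "j = a - 5"
  have j: "a = j + 5" using \<open>\<not> a < 6\<close> by (simp add: j_def)
  interpret unit_tiling p "a - 1" "{1, 3}" "ind (a - 1)"
    using assms(3) j by simp
  obtain g where g: "coprime g (int p)" "ind (a - 1) g = 1" by (rule exists_one)
  have step: "ind (a - 1) (9 * u) = ind (a - 1) u" if "coprime u (int p)" for u
    using tile[of u] tile[of "3 * u"] that assms(1) by simp
  have "ind (a - 1) (9 ^ n * g) = 1" for n
  proof (induction n)
    case (Suc n)
    have "coprime (9 ^ n * g) (int p)" using g assms(1) by simp
    from step[OF this] Suc show ?case by (simp add: mult.assoc)
  qed (use g in simp)
  then have n: "ind (a - 1) (9 ^ (2 ^ j) * g) = 1" .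
  have "[9 ^ (2 ^ j) = 1] (mod (2 :: int) ^ (j + 3))"
    using cong_dvd_modulus[OF nine_power_cong[of j], of "2 ^ (j + 3)"] by (simp add: le_imp_power_dvd cong_def)
  then have "[9 ^ (2 ^ j) * g = 1 * g] (mod 2 ^ (j + 3))" by (intro cong_mult) auto
  then have "[9 ^ (2 ^ j) * g = 1 * g] (mod int p ^ (a - 1))"
    using ind_injective[OF n, of g 2] g assms by (simp add: j add.commute)
  then have "[9 ^ (2 ^ j) = 1] (mod (2 :: int) ^ (j + 4))"
    using g assms(1) by (subst (asm) cong_mult_rcancel) (simp_all add: j add.commute)
  then have "[1 + 2 ^ (j + 3) = 1] (mod (2 :: int) ^ (j + 4))"
    using nine_power_cong[of j] cong_trans cong_sym by blast
  then show False by (simp add: cong_iff_dvd_diff power_add)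
qed

text \<open>The \<open>2 ^ (j + 1)\<close>-th powers of the tile are 1, 1,
  \<open>9 ^ (2 ^ j)\<close> and \<open>25 ^ (2 ^ j)\<close>; by parity the indicator agrees at the
  last two. These agree modulo \<open>2 ^ (a - 1)\<close> and differ modulo \<open>2 ^ a\<close>,
  against \<open>ind_inj_1\<close>.\<close>

lemma binary_exponent_2_5:
  assumes "p = 2" "unit_multipliers = {-1, 1, 3, 5}"
  shows "a < 6"
proof (rule ccontr)
  assume "\<not> a < 6"
  define j where "j = a - 5"
  have j: "a = j + 5" using \<open>\<not> a < 6\<close> by (simp add: j_def)
  interpret unit_tiling p a "{-1, 1, 3, 5}" "ind a"
    using unit_tiling_0 assms(2) j by simp
  have sq: "x ^ (2 ^ Suc j) = (x ^ 2) ^ (2 ^ j)" for x :: int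
    by (simp only: power_mult[symmetric] power_Suc)
  have eq: "ind a (9 ^ (2 ^ j) * u) = ind a (25 ^ (2 ^ j) * u)" if "coprime u (int p)" for u
    using frobenius[of "Suc j" u] that assms(1) f_01[of "9 ^ (2 ^ j) * u"] f_01[of "25 ^ (2 ^ j) * u"]
    unfolding assms(1) sq by auto
  obtain g where g: "coprime g (int p)" "ind a g = 1" by (rule exists_one)
  \<comment> \<open>Dividing by \<open>9 ^ (2 ^ j)\<close> gives a unit \<open>y * g\<close> whose
    multiple by that power is marked.\<close>
  obtain y where y: "[9 ^ (2 ^ j) * y = 1] (mod m)" "coprime y (int p)"
    using inverse_mod[of "9 ^ (2 ^ j)"] assms(1) by auto
  have "[9 ^ (2 ^ j) * y * g = 1 * g] (mod int p ^ a)"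
    using y(1) by (intro cong_mult) (auto simp: m)
  then have one: "ind a (9 ^ (2 ^ j) * (y * g)) = 1"
    using ind_cong g by (simp add: mult.assoc)
  with eq[of "y * g"] y g have two: "ind a (25 ^ (2 ^ j) * (y * g)) = 1" by simp
  have "[25 ^ (2 ^ j) = 9 ^ (2 ^ j) + 2 ^ (j + 4)] (mod (2 :: int) ^ (j + 4))"
    using nine_25_power_cong[of j] by (rule cong_dvd_modulus) (simp add: le_imp_power_dvd)
  then have "[25 ^ (2 ^ j) = 9 ^ (2 ^ j)] (mod (2 :: int) ^ (j + 4))"
    by (simp add: cong_def)
  then have "[25 ^ (2 ^ j) * (y * g) = 9 ^ (2 ^ j) * (y * g)] (mod int p ^ (a - 1))"
    using assms(1) by (intro cong_mult) (simp_all add: j add.commute)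
  then have "[25 ^ (2 ^ j) * (y * g) = 9 ^ (2 ^ j) * (y * g)] (mod int p ^ a)"
    using one two j by (intro ind_inj_1) simp_all
  then have "[25 ^ (2 ^ j) = 9 ^ (2 ^ j)] (mod (2 :: int) ^ (j + 5))"
    using y g assms(1) by (subst (asm) cong_mult_rcancel) (simp_all add: j add.commute)
  then have "[9 ^ (2 ^ j) + 2 ^ (j + 4) = 9 ^ (2 ^ j)] (mod (2 :: int) ^ (j + 5))"
    using nine_25_power_cong[of j] cong_trans cong_sym by blast
  then show False by (simp add: cong_iff_dvd_diff power_add)
qed

text \<open>Adding the values at \<open>u\<close> and \<open>- u\<close> reduces the tile to
  \<open>{1, 3}\<close>, so \<open>9 ^ (2 ^ j) * g\<close> or its negative is marked. As
  \<open>9 ^ (2 ^ j)\<close> is 1 modulo \<open>2 ^ (a - 1)\<close> only, the first case contradicts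
  the multiplier 2, the second the pair 2 and -2.\<close>

lemma binary_exponent_3_4:
  assumes "p = 2" "unit_multipliers = {-3, -1, 1, 3}" "- 2 \<in> S"
  shows "a < 6"
proof (rule ccontr)
  assume "\<not> a < 6"
  define j where "j = a - 4"
  have j: "a = j + 4" using \<open>\<not> a < 6\<close> by (simp add: j_def)
  interpret unit_tiling p a "{-3, -1, 1, 3}" "ind a"
    using unit_tiling_0 assms(2) j by simp
  define f' where "f' u = ind a u + ind a (- u)" for u
  have step: "f' (9 * u) = f' u" if "coprime u (int p)" for u
    using tile[of u] tile[of "3 * u"] that assms(1) by (simp add: f'_def)
  obtain g where g: "coprime g (int p)" "ind a g = 1" by (rule exists_one)
  have all: "f' (9 ^ n * g) = f' g" for n
  proof (induction n)
    case (Suc n)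
    have "coprime (9 ^ n * g) (int p)" using g assms(1) by simp
    from step[OF this] Suc show ?case by (simp add: mult.assoc)
  qed simp
  have "ind a (9 ^ (2 ^ j) * g) = 1 \<or> ind a (- (9 ^ (2 ^ j) * g)) = 1"
    using all[of "2 ^ j"] g f_01[of "- g"] f_01[of "9 ^ (2 ^ j) * g"] f_01[of "- (9 ^ (2 ^ j) * g)"]
    by (auto simp: f'_def)
  moreover
  have "[9 ^ (2 ^ j) = 1] (mod (2 :: int) ^ (j + 3))"
    using cong_dvd_modulus[OF nine_power_cong[of j], of "2 ^ (j + 3)"] by (simp add: le_imp_power_dvd cong_def)
  then have c: "[9 ^ (2 ^ j) * g = 1 * g] (mod int p ^ (a - 1))"
    using assms(1) by (intro cong_mult) (auto simp: j add.commute)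
  moreover have False if "ind a (9 ^ (2 ^ j) * g) = 1"
  proof -
    have "[9 ^ (2 ^ j) * g = 1 * g] (mod int p ^ a)"
      using ind_inj_1[OF _ that, of g] g c j by simp
    then have "[9 ^ (2 ^ j) = 1] (mod (2 :: int) ^ (j + 4))"
      using g assms(1) by (subst (asm) cong_mult_rcancel) (simp_all add: j add.commute)
    then have "[1 + 2 ^ (j + 3) = 1] (mod (2 :: int) ^ (j + 4))"
      using nine_power_cong[of j] cong_trans cong_sym by blast
    then show False by (simp add: cong_iff_dvd_diff power_add)
  qed
  moreover have False if "ind a (- (9 ^ (2 ^ j) * g)) = 1"
  proof -
    have "[1 * (- (9 ^ (2 ^ j) * g)) = - 1 * g] (mod int p ^ (a - 1))"
      using c by (simp add: cong_minus_minus_iff)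
    from packing[OF g(2) that _ _ _ _ this] show False
      using assms p_in_S j by simp
  qed
  ultimately show False by blast
qed

end

subsection \<open>Splittings with two elements\<close>

text \<open>Both elements of \<open>B\<close> are units, and after scaling they are 1 and \<open>c\<close>.\<close>

definition no_two_splitters :: "int \<Rightarrow> int \<Rightarrow> int \<Rightarrow> bool" where
  "no_two_splitters k1 k2 m \<longleftrightarrow>
    list_all (\<lambda>b. gcd b m = 1 \<or> \<not> distinct (map (\<lambda>s. s * b mod m) (0 # multipliers k1 k2))) [0..m - 1] \<and>
    list_all (\<lambda>c. c = 1 \<or> gcd c m \<noteq> 1 \<or>
      \<not> distinct (map (\<lambda>s. s mod m) (multipliers k1 k2) @ map (\<lambda>s. s * c mod m) (multipliers k1 k2))) [0..m - 1]"

context perfect_splitting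
begin

lemma no_two_splitters:
  assumes "no_two_splitters k1 k2 m"
  shows "m \<noteq> 2 * (k1 + k2) + 1"
proof
  assume "m = 2 * (k1 + k2) + 1"
  then have "int (card B) * (k1 + k2) = 2 * (k1 + k2)" using card_B by simp
  then have "int (card B) = 2" using k_pos by (simp only: mult_cancel_right) simp
  then have "card B = 2" by simp
  then obtain b b' where B: "B = {b, b'}" "b \<noteq> b'" by (auto simp: card_2_iff)
  have unit: "coprime b m" if b: "b \<in> B" for b
  proof -
    have "s * b mod m \<noteq> 0" if "s \<in> S" for s
      using bij_betwE[OF bij_mult] that b by fastforce
    moreover have "inj_on (\<lambda>s. s * b mod m) S"
      using mult_inj[OF _ b _ b] by (auto simp: inj_on_def cong_def)
    ultimately have "distinct (map (\<lambda>s. s * b mod m) (0 # multipliers k1 k2))"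
      by (auto simp: distinct_map distinct_multipliers set_multipliers)
    moreover have "b \<in> set [0..m - 1]" using B_subset b by auto
    ultimately show ?thesis
      using assms by (auto simp: no_two_splitters_def list_all_iff coprime_iff_gcd_eq_1)
  qed
  have bB: "b \<in> B" "b' \<in> B" using B by auto
  obtain y where y: "[b * y = 1] (mod m)"
    using cong_solve_coprime_int[OF unit[OF bB(1)]] by blast
  then have "coprime (b * y) m" by (metis cong_imp_coprime cong_sym coprime_1_left)
  define c where "c = b' * y mod m"
  have bc: "[c * b = b'] (mod m)"
  proof -
    have "[c * b = b' * y * b] (mod m)" unfolding c_def by (intro cong_mult) auto
    also have "b' * y * b = b' * (b * y)" by simp
    also have "[b' * (b * y) = b' * 1] (mod m)" using y by (intro cong_mult) auto
    finally show ?thesis by simp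
  qed
  have "gcd c m = 1"
    using m_pos unit[OF bB(2)] \<open>coprime (b * y) m\<close> by (simp add: c_def coprime_iff_gcd_eq_1[symmetric])
  moreover have "c \<noteq> 1"
  proof
    assume "c = 1"
    then have "[b = b'] (mod m)" using bc by simp
    then show False using B B_subset by (auto simp: cong_def)
  qed
  moreover have "c \<in> set [0..m - 1]" using m_pos by (simp add: c_def)
  moreover have "distinct (map (\<lambda>s. s mod m) (multipliers k1 k2) @ map (\<lambda>s. s * c mod m) (multipliers k1 k2))"
  proof -
    have "inj_on (\<lambda>s. s mod m) S"
    proof (rule inj_onI)
      fix s s' assume s: "s \<in> S" "s' \<in> S" "s mod m = s' mod m"
      then have "[s * b = s' * b] (mod m)" by (intro cong_mult) (auto simp: cong_def)
      then show "s = s'" using mult_inj s bB by blast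
    qed
    moreover have "inj_on (\<lambda>s. s * c mod m) S"
    proof (rule inj_onI)
      fix s s' assume s: "s \<in> S" "s' \<in> S" "s * c mod m = s' * c mod m"
      then have "[s * c = s' * c] (mod m)" by (simp add: cong_def)
      then have "[s * c * b = s' * c * b] (mod m)" by (rule cong_scalar_right)
      moreover have t: "[t * c * b = t * b'] (mod m)" for t
        using cong_mult[OF cong_refl bc, of t] by (simp add: mult.assoc)
      ultimately have "[s * b' = s' * b'] (mod m)"
        using cong_trans[OF cong_sym[OF t[of s]] cong_trans[OF _ t[of s']]] by blast
      then show "s = s'" using mult_inj s bB by blast
    qed
    moreover have False if s: "s \<in> S" "s' \<in> S" "s mod m = s' * c mod m" for s s'
    proof -
      have "[s = s' * c] (mod m)" using s by (simp add: cong_def)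
      then have "[s * b = s' * c * b] (mod m)" by (rule cong_scalar_right)
      also have "s' * c * b = s' * (c * b)" by simp
      also have "[s' * (c * b) = s' * b'] (mod m)" using bc by (intro cong_mult) auto
      finally show False using mult_inj[OF s(1) bB(1) s(2) bB(2)] B(2) by blast
    qed
    ultimately show ?thesis
      by (auto simp: distinct_map distinct_multipliers set_multipliers)
  qed
  ultimately show False
    using assms by (auto simp: no_two_splitters_def list_all_iff)
qed

end

lemma exceptional_no_two_splitters:
  "list_all (\<lambda>(k1, k2, m). no_two_splitters k1 k2 m)
    exceptional_orders"
  by code_simp

subsection \<open>The remaining prime powers\<close>

definition unit_list :: "int \<Rightarrow> int \<Rightarrow> int \<Rightarrow> int list" where
  "unit_list k1 k2 p = filter (\<lambda>s. \<not> p dvd s) (multipliers k1 k2)"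

definition level_one_list :: "int \<Rightarrow> int \<Rightarrow> int \<Rightarrow> int list" where
  "level_one_list k1 k2 p =
    map (\<lambda>s. s div p) (filter (\<lambda>s. p dvd s \<and> \<not> p ^ 2 dvd s) (multipliers k1 k2))"

definition wieferich_bound :: "int \<Rightarrow> int \<Rightarrow> int \<Rightarrow> bool" where
  "wieferich_bound k1 k2 p \<longleftrightarrow> (let U = unit_list k1 k2 p in
    odd p \<and> int (length U) = p \<and> 1 \<in> set U \<and> 2 \<in> set U \<and> \<not> p ^ 2 dvd 2 ^ (nat p - 1) - 1)"

definition square_collision :: "int \<Rightarrow> int \<Rightarrow> int \<Rightarrow> bool" where
  "square_collision k1 k2 p \<longleftrightarrow> (let U = unit_list k1 k2 p in
    int (length U) = p \<and> 1 \<in> set U \<and>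
    list_ex (\<lambda>w. let v = w ^ nat p in list_ex (\<lambda>t. list_ex (\<lambda>s. s \<noteq> t \<and> p ^ 2 dvd s - t * v) U) U) U)"

definition ternary_bound :: "int \<Rightarrow> int \<Rightarrow> int \<Rightarrow> bool" where
  "ternary_bound k1 k2 p \<longleftrightarrow> (let U = unit_list k1 k2 p in
    p = 3 \<and> 3 dvd length U \<and> 1 \<in> set U \<and> list_all (\<lambda>s. s = 1 \<or> s mod 9 \<noteq> 1) U \<and>
    (- 3 \<in> set (multipliers k1 k2) \<or> balanced k1 k2 3 \<and> level_one_list k1 k2 p = [1, 2]))"

definition quinary_bound :: "int \<Rightarrow> int \<Rightarrow> int \<Rightarrow> bool" where
  "quinary_bound k1 k2 p \<longleftrightarrow> (let U = unit_list k1 k2 p in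
    p = 5 \<and>
    (U \<in> set [[1, 2, 3, 4, 6, 7, 8, 9, 11, 12], [-1, 1, 2, 3, 4, 6, 7, 8, 9, 11],
         [-2, -1, 1, 2, 3, 4, 6, 7, 8, 9]] \<and> balanced k1 k2 5 \<and> level_one_list k1 k2 p = [1, 2]
     \<or> U \<in> set [[-4, -3, -2, -1, 1, 2, 3, 4, 6, 7], [-6, -4, -3, -2, -1, 1, 2, 3, 4, 6]]
       \<and> - 5 \<in> set (multipliers k1 k2)))"

definition nonary_bound :: "int \<Rightarrow> int \<Rightarrow> int \<Rightarrow> bool" where
  "nonary_bound k1 k2 p \<longleftrightarrow> (let T = level_one_list k1 k2 p in
    p = 3 \<and> balanced k1 k2 3 \<and> 9 \<in> set (multipliers k1 k2) \<and> T \<in> set [[1, 2, 4], [-1, 1, 2]])"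

definition binary_bound :: "int \<Rightarrow> int \<Rightarrow> int \<Rightarrow> bool" where
  "binary_bound k1 k2 p \<longleftrightarrow>
    p = 2 \<and>
    (balanced k1 k2 2 \<and> 4 \<in> set (multipliers k1 k2) \<and> level_one_list k1 k2 p = [1, 3]
     \<or> unit_list k1 k2 p = [-1, 1, 3, 5]
     \<or> unit_list k1 k2 p = [-3, -1, 1, 3] \<and> - 2 \<in> set (multipliers k1 k2))"

text \<open>\<open>Some n\<close> bounds the exponent strictly. The value 3 reflects that
  \<open>a - 2\<close> must be positive; working modulo \<open>p ^ (a - 1)\<close> shifts it to 4.
  Exponents below \<open>n\<close> are examined one by one.\<close>

definition exponent_bound :: "int \<Rightarrow> int \<Rightarrow> int \<Rightarrow> nat option" where
  "exponent_bound k1 k2 p =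
    (if wieferich_bound k1 k2 p \<or> ternary_bound k1 k2 p \<or> quinary_bound k1 k2 p then Some 3
     else if nonary_bound k1 k2 p then Some 4
     else if binary_bound k1 k2 p then Some 6 else None)"

definition prime_power_check :: "int \<Rightarrow> int \<Rightarrow> int \<Rightarrow> bool" where
  "prime_power_check k1 k2 p \<longleftrightarrow> p \<in> set (multipliers k1 k2) \<and>
    (case exponent_bound k1 k2 p of None \<Rightarrow> False | Some n \<Rightarrow>
      list_all (\<lambda>a. let m = p ^ a in
        m = 1 \<or> m = k1 + k2 + 1 \<or> k1 = 0 \<and> m = 2 * (k1 + k2) + 1 \<or> \<not> k1 + k2 dvd m - 1
        \<or> a = 2 \<and> square_collision k1 k2 p
        \<or> m = 2 * (k1 + k2) + 1 \<and> no_two_splitters k1 k2 m) [0..<n])"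

lemma prime_power_cases_checked:
  "list_all (\<lambda>(k1, k2, p). prime_power_check k1 k2 p) prime_power_cases"
  by code_simp

context prime_power_splitting
begin

lemma unit_multipliers_list: "unit_multipliers = set (unit_list k1 k2 (int p))"
  by (auto simp: unit_multipliers_def unit_list_def set_multipliers)

lemma card_unit_list: "card (set (unit_list k1 k2 q)) = length (unit_list k1 k2 q)"
  by (rule distinct_card) (simp add: unit_list_def distinct_multipliers)

lemma level_one_multipliers_list: "level_one_multipliers = set (level_one_list k1 k2 (int p))"
  unfolding level_one_multipliers_eq level_one_list_def by simp

lemma exponent_bound:
  assumes "exponent_bound k1 k2 (int p) = Some n"
  shows "a < n"
proof -
  have U: "unit_multipliers = set xs" if "unit_list k1 k2 (int p) = xs" for xs
    using that by (simp add: unit_multipliers_list)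
  have T: "level_one_multipliers = set xs" if "level_one_list k1 k2 (int p) = xs" for xs
    using that by (simp add: level_one_multipliers_list)
  have tiling: "unit_tiling p (a - 1) level_one_multipliers (ind (a - 1))"
    if "balanced k1 k2 (int p)" "2 \<le> a"
    using that by (intro unit_tiling_1)
  consider "wieferich_bound k1 k2 (int p)" "n = 3" | "ternary_bound k1 k2 (int p)" "n = 3"
    | "quinary_bound k1 k2 (int p)" "n = 3" | "nonary_bound k1 k2 (int p)" "n = 4"
    | "binary_bound k1 k2 (int p)" "n = 6"
    using assms by (auto simp: exponent_bound_def split: if_splits)
  then show ?thesis
  proof cases
    case 1
    then show ?thesis
      using card_units_eq_p_small
      by (simp add: wieferich_bound_def Let_def card_unit_list unit_multipliers_list cong_iff_dvd_diff)
  next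
    case 2
    then have p: "p = 3" by (simp add: ternary_bound_def Let_def)
    have disj: "- 3 \<in> S \<or> (2 \<le> a \<longrightarrow> unit_tiling p (a - 1) {1, 2} (ind (a - 1)))"
      using 2 tiling T[of "[1, 2]"] p by (auto simp: ternary_bound_def Let_def set_multipliers)
    have "a < 3"
      by (rule ternary_exponent[OF p _ _ _ disj]; unfold unit_multipliers_list card_unit_list)
        (use 2 in \<open>auto simp: ternary_bound_def Let_def list_all_iff\<close>)
    with 2 show ?thesis by simp
  next
    case 3
    then have p: "p = 5" by (simp add: quinary_bound_def Let_def)
    have "a < 3"
    proof (rule quinary_exponent[OF p], goal_cases)
      case 1
      from 3 consider
        "unit_list k1 k2 (int p) \<in> set [[1, 2, 3, 4, 6, 7, 8, 9, 11, 12], [-1, 1, 2, 3, 4, 6, 7, 8, 9, 11],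
           [-2, -1, 1, 2, 3, 4, 6, 7, 8, 9]]" "balanced k1 k2 5" "level_one_list k1 k2 (int p) = [1, 2]"
        | "unit_list k1 k2 (int p) \<in> set [[-4, -3, -2, -1, 1, 2, 3, 4, 6, 7], [-6, -4, -3, -2, -1, 1, 2, 3, 4, 6]]"
          "- 5 \<in> set (multipliers k1 k2)"
        unfolding quinary_bound_def Let_def by blast
      then show ?case
      proof cases
        case 1
        then have "2 \<le> a \<longrightarrow> unit_tiling p (a - 1) {1, 2} (ind (a - 1))"
          using tiling T[of "[1, 2]"] p by simp
        moreover have "unit_multipliers \<in> set ` set [[1, 2, 3, 4, 6, 7, 8, 9, 11, 12],
            [-1, 1, 2, 3, 4, 6, 7, 8, 9, 11], [-2, -1, 1, 2, 3, 4, 6, 7, 8, 9]]"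
          unfolding unit_multipliers_list using 1(1) by (rule imageI)
        ultimately show ?thesis by simp
      next
        case 2
        then have "- 5 \<in> S" by (simp add: set_multipliers)
        moreover have "unit_multipliers \<in> set ` set [[-4, -3, -2, -1, 1, 2, 3, 4, 6, 7],
            [-6, -4, -3, -2, -1, 1, 2, 3, 4, 6]]"
          unfolding unit_multipliers_list using 2(1) by (rule imageI)
        ultimately show ?thesis by simp
      qed
    qed
    with 3 show ?thesis by simp
  next
    case 4
    then have p: "p = 3" by (simp add: nonary_bound_def Let_def)
    have "level_one_list k1 k2 (int p) \<in> set [[1, 2, 4], [-1, 1, 2]]"
      using 4 unfolding nonary_bound_def Let_def by blast
    then have "level_one_multipliers \<in> set ` set [[1, 2, 4], [-1, 1, 2]]"
      unfolding level_one_multipliers_list by (rule imageI)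
    then have "level_one_multipliers = {1, 2, 4} \<or> level_one_multipliers = {-1, 1, 2}"
      by simp
    then have T: "card level_one_multipliers = 3" "1 \<in> level_one_multipliers" "2 \<in> level_one_multipliers"
      by auto
    have "9 \<in> S" using 4 by (simp add: nonary_bound_def Let_def set_multipliers)
    moreover have "2 \<le> a \<longrightarrow> unit_tiling p (a - 1) level_one_multipliers (ind (a - 1))"
      using 4 tiling p by (simp add: nonary_bound_def Let_def)
    ultimately have "a < 4" by (rule nonary_exponent[OF p T])
    with 4 show ?thesis by simp
  next
    case 5
    then have p: "p = 2" by (simp add: binary_bound_def)
    from 5 consider "balanced k1 k2 2" "4 \<in> set (multipliers k1 k2)" "level_one_list k1 k2 (int p) = [1, 3]"
      | "unit_list k1 k2 (int p) = [-1, 1, 3, 5]"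
      | "unit_list k1 k2 (int p) = [-3, -1, 1, 3]" "- 2 \<in> set (multipliers k1 k2)"
      unfolding binary_bound_def by blast
    then have "a < 6"
    proof cases
      case 1
      then show ?thesis
        using binary_exponent_level_one tiling T[of "[1, 3]"] p by (simp add: set_multipliers)
    next
      case 2
      then show ?thesis using binary_exponent_2_5 U[of "[-1, 1, 3, 5]"] p by simp
    next
      case 3
      then show ?thesis using binary_exponent_3_4 U[of "[-3, -1, 1, 3]"] p by (simp add: set_multipliers)
    qed
    with 5 show ?thesis by simp
  qed
qed

lemma square_collision:
  assumes "square_collision k1 k2 (int p)"
  shows "a \<noteq> 2"
proof -
  obtain s t w where "s \<in> unit_multipliers" "t \<in> unit_multipliers" "w \<in> unit_multipliers"
    "s \<noteq> t" "[s = t * w ^ p] (mod int p ^ 2)"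
    using assms by (auto simp: square_collision_def Let_def list_ex_iff unit_multipliers_list cong_iff_dvd_diff)
  with assms show ?thesis
    using card_units_eq_p_square
    by (auto simp: square_collision_def Let_def card_unit_list unit_multipliers_list)
qed

end

context perfect_splitting
begin

lemma prime_power_order:
  assumes "prime_power_check k1 k2 p" "prime p" "m = p ^ a"
  shows "m = 1 \<or> m = k1 + k2 + 1 \<or> (k1 = 0 \<and> m = 2 * (k1 + k2) + 1)"
proof -
  obtain q where q: "p = int q"
    using assms(2) prime_ge_0_int[of p] zero_le_imp_eq_int by blast
  have "p \<in> S" using assms(1) by (simp add: prime_power_check_def set_multipliers)
  then interpret prime_power_splitting k1 k2 m B S q a
    using assms(2,3) q unfolding S_def by unfold_locales simp_all
  obtain n where n: "exponent_bound k1 k2 p = Some n"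
    using assms(1) by (auto simp: prime_power_check_def split: option.splits)
  then have "a < n" using exponent_bound[of n] by (simp add: q)
  then have "m = 1 \<or> m = k1 + k2 + 1 \<or> k1 = 0 \<and> m = 2 * (k1 + k2) + 1 \<or> \<not> k1 + k2 dvd m - 1
        \<or> a = 2 \<and> square_collision k1 k2 p
        \<or> m = 2 * (k1 + k2) + 1 \<and> no_two_splitters k1 k2 m"
    using assms(1,3) n by (auto simp: prime_power_check_def Let_def list_all_iff)
  moreover have "k1 + k2 dvd m - 1" using card_B by (metis dvd_triv_right)
  moreover have "\<not> (a = 2 \<and> square_collision k1 k2 p)" using square_collision by (auto simp: q)
  ultimately show ?thesis using no_two_splitters by blast
qed

end

theorem theorem1p5:
  fixes k1 k2 m :: int
  assumes "0 \<le> k1" and "k1 \<le> k2"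
    and "4 \<le> k1 + k2" and "k1 + k2 \<le> 14"
    and "m > 0"
    and "\<exists>B. purely_singular_perfect_B_set k1 k2 m B"
  shows "m = 1 \<or> m = k1 + k2 + 1 \<or> (k1 = 0 \<and> m = 2 * (k1 + k2) + 1)"
proof -
  obtain B where perfect: "perfect_B_set k1 k2 m B"
    and singular: "\<And>p. prime p \<Longrightarrow> p dvd m \<Longrightarrow> \<exists>k. 0 < k \<and> k \<le> k2 \<and> p dvd k"
    using assms(6) by (auto simp: purely_singular_perfect_B_set_def)
  interpret perfect_splitting k1 k2 m B "{-k1..k2} - {0}"
    using assms perfect by unfold_locales auto
  have mem: "k1 \<in> set [0..7]" "k2 \<in> set [2..14]"
    unfolding set_upto using assms by auto
  have "list_ex (\<lambda>(ks, t). (k1, k2) \<in> set ks) certificates"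
    using bspec[OF bspec[OF certificates_complete[unfolded list_all_iff] mem(1)] mem(2)] assms
    by blast
  then obtain ks t where ks: "(ks, t) \<in> set certificates" "(k1, k2) \<in> set ks"
    by (auto simp: list_ex_iff)
  have "check_pair k1 k2 t"
    using bspec[OF certificates_correct[unfolded list_all_iff] ks(1)] ks(2) by auto
  moreover have small: "p \<le> k2" if p: "prime p" "p dvd m" for p
  proof -
    obtain k where "0 < k" "k \<le> k2" "p dvd k" using singular[OF p] by blast
    then show ?thesis using zdvd_imp_le[of p k] by simp
  qed
  moreover have "p \<in> set small_primes" if "prime p" "p dvd m" for p
    using small[OF that] prime_le_14[OF that(1)] assms by simp
  moreover have "\<not> p dvd m" if "p \<in> set (filter (\<lambda>p. p dvd k1 + k2 \<or> k2 < p) small_primes)" for p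
  proof
    assume "p dvd m"
    have "prime p" using that prime_small_primes by simp
    with small[OF _ \<open>p dvd m\<close>] that have "p dvd k1 + k2" by auto
    then have "p dvd int (card B) * (k1 + k2)" by (rule dvd_mult)
    then have "p dvd m - 1" unfolding card_B .
    with \<open>p dvd m\<close> have "p dvd m - (m - 1)" by (rule dvd_diff)
    then have "p dvd 1" by simp
    with \<open>prime p\<close> show False using not_prime_unit by blast
  qed
  ultimately have "m \<in> set (allowed_orders k1 k2)
      \<or> (\<exists>p\<in>set (select prime_power_cases k1 k2). \<exists>a. m = p ^ a)"
    unfolding check_pair_def by (intro check_sound[where x = m]) auto
  then show ?thesis
  proof
    assume "m \<in> set (allowed_orders k1 k2)"
    moreover have "m \<notin> set (select exceptional_orders k1 k2)"
      using exceptional_no_two_splitters no_two_splitters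
      by (auto simp: select_def exceptional_orders_def)
    ultimately show ?thesis by (auto simp: allowed_orders_def split: if_splits)
  next
    assume "\<exists>p\<in>set (select prime_power_cases k1 k2). \<exists>a. m = p ^ a"
    then obtain p a where p: "(k1, k2, p) \<in> set prime_power_cases" "m = p ^ a"
      by (auto simp: select_def)
    then have "prime_power_check k1 k2 p"
      using prime_power_cases_checked by (auto simp: list_all_iff)
    moreover have "prime p" using p(1) by (auto simp: prime_power_cases_def)
    ultimately show ?thesis using p(2) by (rule prime_power_order)
  qed
qed

end
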